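(* Let $(X,\mathcal{B},\mu)$ be a standard Borel probability space (in the sense of the context). Let $T:X\to X$ be a continuous ergodic $\mu$-preserving transformation. Let $\nu$ be a Borel probability measure on $X$ such that $$\frac{1}{N}\sum_{n=0}^{N-1} T^n_*\nu \longrightarrow \mu \quad (N\to\infty)$$ in the weak-$*$ topology. Then for $\nu$-almost every $x\in X$ there exists a set (sequence) $A(x)\subseteq\mathbb{N}$ of upper density $1$ such that for all $\psi\in C_c(X)$, $$\lim_{\substack{N\to\infty\\ N\in A(x)}}\frac1N\sum_{n=0}^{N-1}\psi(T^n x)=\int\psi\,d\mu .$$
   Context: "Standard Borel space" $(X,\mathcal{B})$ here means: $X$ is a locally compact (Hausdorff), second countable topological space and $\mathcal{B}$ is its Borel $\sigma$-algebra; $(X,\mathcal B,\mu)$ is a standard Borel probability space if moreover $\mu$ is a probability measure on $\mathcal B$. $C_c(X)$ is the space of continuous compactly supported functions. Weak-$*$ convergence of measures means convergence of integrals of every $\psi\in C_c(X)$. $T^n_*\nu$ is the pushforward of $\nu$ under $T^n$. The upper density of $A\subseteq\mathbb{N}$ is $\overline d(A)=\limsup_{N\to\infty}\frac{\#(A\cap[1,N])}{N}$. *)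

theory Defs
  imports "HOL-Probability.Probability"
begin

definition measure_preserving_map :: "'a measure \<Rightarrow> ('a \<Rightarrow> 'a) \<Rightarrow> bool" where
  "measure_preserving_map M T \<longleftrightarrow> T \<in> M \<rightarrow>\<^sub>M M \<and> distr M M T = M"

definition ergodic_map :: "'a measure \<Rightarrow> ('a \<Rightarrow> 'a) \<Rightarrow> bool" where
  "ergodic_map M T \<longleftrightarrow>
     measure_preserving_map M T \<and>
     (\<forall>A\<in>sets M. T -` A \<inter> space M = A \<longrightarrow> A \<in> null_sets M \<or> space M - A \<in> null_sets M)"

definition C_c :: "('a::topological_space \<Rightarrow> real) set" where
  "C_c = {\<psi>. continuous_on UNIV \<psi> \<and> compact (closure {x. \<psi> x \<noteq> 0})}"

text \<open>Convergence is tested against compactly supported functions only, not against all bounded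
  continuous ones, so mass may escape to infinity in general.\<close>

definition weak_star_conv :: "(nat \<Rightarrow> 'a::topological_space measure) \<Rightarrow> 'a measure \<Rightarrow> bool" where
  "weak_star_conv M_seq M \<longleftrightarrow> (\<forall>\<psi>\<in>C_c. (\<lambda>N. \<integral>x. \<psi> x \<partial>M_seq N) \<longlonglongrightarrow> (\<integral>x. \<psi> x \<partial>M))"

text \<open>The measure \<open>(1/N) \<Sum>n<N. T\<^sup>n\<^sub>* \<nu>\<close>; for \<open>N = 0\<close> it is the zero measure.\<close>

definition cesaro_measure ::
    "('a::topological_space \<Rightarrow> 'a) \<Rightarrow> 'a measure \<Rightarrow> nat \<Rightarrow> 'a measure" where
  "cesaro_measure T \<nu> N =
     measure_of UNIV (sets borel) (\<lambda>A. (\<Sum>n<N. emeasure (distr \<nu> borel (T ^^ n)) A) / of_nat N)"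

text \<open>The set function given to \<^const>\<open>measure_of\<close> is indeed a measure, so the definition does not
  fall back to the zero measure.\<close>

lemma sets_cesaro_measure [simp, measurable_cong]: "sets (cesaro_measure T \<nu> N) = sets borel"
  unfolding cesaro_measure_def
  using sets.sigma_sets_eq[of borel] by (simp add: sets_measure_of_conv)

lemma space_cesaro_measure [simp]: "space (cesaro_measure T \<nu> N) = UNIV"
  unfolding cesaro_measure_def by (simp add: space_measure_of_conv)

lemma emeasure_cesaro_measure:
  assumes "A \<in> sets borel"
  shows "emeasure (cesaro_measure T \<nu> N) A =
    (\<Sum>n<N. emeasure (distr \<nu> borel (T ^^ n)) A) / of_nat N"
  unfolding cesaro_measure_def
proof (rule emeasure_measure_of_sigma)
  show "A \<in> sets borel" by fact
  show "sigma_algebra UNIV (sets (borel :: 'a measure))"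
    by (metis sets.sigma_algebra_axioms space_borel)
  show "positive (sets borel) (\<lambda>A. (\<Sum>n<N. emeasure (distr \<nu> borel (T ^^ n)) A) / of_nat N)"
    by (simp add: positive_def)
  show "countably_additive (sets borel)
      (\<lambda>A. (\<Sum>n<N. emeasure (distr \<nu> borel (T ^^ n)) A) / of_nat N)"
  proof (rule countably_additiveI)
    fix F :: "nat \<Rightarrow> 'a set"
    assume F: "range F \<subseteq> sets borel" "disjoint_family F"
    have "(\<Sum>i. (\<Sum>n<N. emeasure (distr \<nu> borel (T ^^ n)) (F i)) / of_nat N) =
        (\<Sum>n<N. (\<Sum>i. emeasure (distr \<nu> borel (T ^^ n)) (F i))) / of_nat N"
      by (simp add: ennreal_suminf_divide suminf_sum)
    also have "\<dots> = (\<Sum>n<N. emeasure (distr \<nu> borel (T ^^ n)) (\<Union>i. F i)) / of_nat N"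
      using F by (subst suminf_emeasure) auto
    finally show "(\<Sum>i. (\<Sum>n<N. emeasure (distr \<nu> borel (T ^^ n)) (F i)) / of_nat N) =
        (\<Sum>n<N. emeasure (distr \<nu> borel (T ^^ n)) (\<Union>i. F i)) / of_nat N" .
  qed
qed

definition upper_density :: "nat set \<Rightarrow> ereal" where
  "upper_density A = limsup (\<lambda>N. ereal (real (card (A \<inter> {1..N})) / real N))"

end

theory Submission
  imports Defs
begin

text \<open>The Birkhoff averages of a mean-zero bounded continuous \<open>f\<close> tend to \<open>0\<close> in \<open>L\<^sup>1(\<mu>)\<close>. This
  transfers to \<open>L\<^sup>1(\<nu>)\<close>: the average \<open>S\<^sub>N f / N\<close> is, up to \<open>O(K / N)\<close>, dominated by the average
  over \<open>n < N\<close> of \<open>\<bar>S\<^sub>K f / K\<bar> \<circ> T\<^sup>n\<close>, whose \<open>\<nu>\<close>-integral is the integral of the bounded continuous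
  function \<open>\<bar>S\<^sub>K f / K\<bar>\<close> against the Cesaro measure and hence converges to its \<open>\<mu>\<close>-integral, which
  is small for large \<open>K\<close>. (As \<open>\<mu>\<close> is a probability measure, no mass escapes.) Applying this to
  countably many convergence-determining functions, with weights \<open>2\<^sup>-\<^sup>i\<close>, gives
  \<open>h\<^sub>N \<ge> 0\<close> with \<open>\<integral> h\<^sub>N d\<nu> \<rightarrow> 0\<close>; the means of \<open>h\<^sub>1, \<dots>, h\<^sub>M\<close> then tend to \<open>0\<close> in
  \<open>L\<^sup>1(\<nu>)\<close>, so almost everywhere along a subsequence of \<open>M\<close>, and this yields a set of upper
  density \<open>1\<close> along which \<open>h\<^sub>N\<close> tends to \<open>0\<close>.\<close>

section \<open>Birkhoff sums and the ergodic theorem\<close>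

definition birkhoff_sum :: "('a \<Rightarrow> 'a) \<Rightarrow> ('a \<Rightarrow> 'b::comm_monoid_add) \<Rightarrow> nat \<Rightarrow> 'a \<Rightarrow> 'b" where
  "birkhoff_sum T f n x = (\<Sum>k<n. f ((T ^^ k) x))"

lemma birkhoff_sum_0 [simp]: "birkhoff_sum T f 0 x = 0"
  by (simp add: birkhoff_sum_def)

lemma birkhoff_sum_Suc: "birkhoff_sum T f (Suc n) x = f x + birkhoff_sum T f n (T x)"
  unfolding birkhoff_sum_def by (subst sum.lessThan_Suc_shift) (simp add: funpow_swap1)

lemma birkhoff_sum_Suc': "birkhoff_sum T f (Suc n) x = birkhoff_sum T f n x + f ((T ^^ n) x)"
  by (simp add: birkhoff_sum_def)

lemma birkhoff_sum_uminus:
  "birkhoff_sum T (\<lambda>x. - f x) n x = - birkhoff_sum T f n (x::'a)" for f :: "'a \<Rightarrow> real"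
  by (simp add: birkhoff_sum_def sum_negf)

lemma birkhoff_sum_diff_const:
  "birkhoff_sum T (\<lambda>x. f x - c) n x = birkhoff_sum T f n (x::'a) - of_nat n * c" for c :: real
  by (simp add: birkhoff_sum_def sum_subtractf)

lemma birkhoff_sum_bound:
  fixes f :: "'a \<Rightarrow> real"
  assumes "\<And>x. \<bar>f x\<bar> \<le> C"
  shows "\<bar>birkhoff_sum T f n x\<bar> \<le> of_nat n * C"
  using sum_bounded_above[of "{..<n}" "\<lambda>k. \<bar>f ((T ^^ k) x)\<bar>" C] assms
  unfolding birkhoff_sum_def by (intro order_trans[OF sum_abs]) auto

lemma measurable_birkhoff_sum [measurable]:
  fixes f :: "'a \<Rightarrow> real"
  assumes [measurable]: "T \<in> M \<rightarrow>\<^sub>M M" "f \<in> borel_measurable M"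
  shows "birkhoff_sum T f n \<in> borel_measurable M"
proof -
  have [measurable]: "(T ^^ k) \<in> M \<rightarrow>\<^sub>M M" for k
    by (rule measurable_compose_n) simp
  show ?thesis
    unfolding birkhoff_sum_def[abs_def] by measurable
qed

text \<open>This is the running maximum \<open>Max {birkhoff_sum T f k x | k. 1 \<le> k \<le> n + 1}\<close>; the recursive
  form is the one in which the cocycle identity is used.\<close>

primrec birkhoff_max :: "('a \<Rightarrow> 'a) \<Rightarrow> ('a \<Rightarrow> real) \<Rightarrow> nat \<Rightarrow> 'a \<Rightarrow> real" where
  "birkhoff_max T f 0 x = f x"
| "birkhoff_max T f (Suc n) x = f x + max 0 (birkhoff_max T f n (T x))"

lemma birkhoff_sum_le_max: "birkhoff_sum T f (Suc n) x \<le> birkhoff_max T f n x"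
proof (induction n arbitrary: x)
  case (Suc n)
  show ?case
    using Suc[of "T x"] by (subst birkhoff_sum_Suc) auto
qed (simp add: birkhoff_sum_Suc)

lemma birkhoff_max_mono_Suc: "birkhoff_max T f n x \<le> birkhoff_max T f (Suc n) x"
proof (induction n arbitrary: x)
  case (Suc n)
  show ?case
    using Suc[of "T x"] by (subst (1 2) birkhoff_max.simps) (intro add_left_mono max.mono, simp_all)
qed simp

lemma birkhoff_max_mono: "m \<le> n \<Longrightarrow> birkhoff_max T f m x \<le> birkhoff_max T f n x"
  by (rule lift_Suc_mono_le[of "\<lambda>n. birkhoff_max T f n x"]) (rule birkhoff_max_mono_Suc)

lemma birkhoff_max_bound:
  assumes "\<And>x. \<bar>f x\<bar> \<le> C"
  shows "\<bar>birkhoff_max T f n x\<bar> \<le> of_nat (Suc n) * C"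
proof (induction n arbitrary: x)
  case (Suc n)
  have "\<bar>birkhoff_max T f (Suc n) x\<bar> \<le> \<bar>f x\<bar> + \<bar>birkhoff_max T f n (T x)\<bar>"
    by auto
  also have "\<dots> \<le> C + of_nat (Suc n) * C"
    by (intro add_mono assms Suc)
  finally show ?case by (simp add: algebra_simps)
qed (use assms in simp)

lemma measurable_birkhoff_max [measurable]:
  assumes [measurable]: "T \<in> M \<rightarrow>\<^sub>M M" "f \<in> borel_measurable M"
  shows "birkhoff_max T f n \<in> borel_measurable M"
proof (induction n)
  case (Suc n)
  note [measurable] = Suc
  show ?case by (simp add: fun_eq_iff[symmetric] cong: measurable_cong)
qed (simp add: assms(2))

text \<open>The set where the running maximum \<open>F\<^sub>n\<close> is unbounded is strictly invariant. If it had full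
  measure, then \<open>0 \<le> \<integral> (F\<^sub>n\<^sub>+\<^sub>1 - F\<^sub>n) = \<integral> (F\<^sub>n\<^sub>+\<^sub>1 - F\<^sub>n \<circ> T) \<rightarrow> \<integral> f\<close>, against \<open>\<integral> f < 0\<close>.\<close>

lemma AE_birkhoff_sum_bdd_above:
  fixes f :: "'a \<Rightarrow> real"
  assumes "prob_space M" "ergodic_map M T"
    and [measurable]: "f \<in> borel_measurable M" and C: "\<And>x. \<bar>f x\<bar> \<le> C"
    and neg: "(\<integral>x. f x \<partial>M) < 0"
  shows "AE x in M. \<exists>B. \<forall>n. birkhoff_sum T f n x \<le> B"
proof -
  interpret prob_space M by fact
  have T [measurable]: "T \<in> M \<rightarrow>\<^sub>M M" and TM: "distr M M T = M"
    and erg: "\<And>A. A \<in> sets M \<Longrightarrow> T -` A \<inter> space M = A \<Longrightarrow> A \<in> null_sets M \<or> space M - A \<in> null_sets M"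
    using assms(2) unfolding ergodic_map_def measure_preserving_map_def by auto
  let ?F = "birkhoff_max T f"
  \<comment> \<open>Natural thresholds \<open>i\<close> make \<open>A\<close> a countable
    combination of measurable sets. Since the maxima increase with \<open>n\<close>, being unbounded
    means tending to infinity.\<close>
  define A where "A = {x \<in> space M. \<forall>i::nat. \<exists>n. real i < ?F n x}"
  have A [measurable]: "A \<in> sets M" unfolding A_def by measurable
  have in_A: "x \<in> A \<longleftrightarrow> x \<in> space M \<and> filterlim (\<lambda>n. ?F n x) at_top sequentially" for x
  proof -
    have "filterlim (\<lambda>n. ?F n x) at_top sequentially \<longleftrightarrow> (\<forall>i::nat. \<exists>n. real i < ?F n x)"
    proof
      assume "filterlim (\<lambda>n. ?F n x) at_top sequentially"
      then show "\<forall>i::nat. \<exists>n. real i < ?F n x"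
        by (metis eventually_happens' filterlim_at_top_dense sequentially_bot)
    next
      assume H: "\<forall>i::nat. \<exists>n. real i < ?F n x"
      show "filterlim (\<lambda>n. ?F n x) at_top sequentially"
        unfolding filterlim_at_top
      proof
        fix Z :: real
        obtain i where "Z \<le> real i" using real_arch_simple by blast
        moreover obtain n where "real i < ?F n x" using H by blast
        ultimately have "Z \<le> ?F n x" by linarith
        then have "Z \<le> ?F m x" if "n \<le> m" for m
          using birkhoff_max_mono[OF that, of T f x] by linarith
        then show "eventually (\<lambda>n. Z \<le> ?F n x) sequentially"
          unfolding eventually_sequentially by blast
      qed
    qed
    then show ?thesis by (auto simp: A_def)
  qed
  have inv: "T x \<in> A \<longleftrightarrow> x \<in> A" if x: "x \<in> space M" for x
  proof -
    have Tx: "T x \<in> space M" using T x by (rule measurable_space)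
    have "T x \<in> A" if "x \<in> A"
    proof -
      have "\<exists>n. real i < ?F n (T x)" for i
      proof -
        \<comment> \<open>The bound \<open>f x \<le> real i'\<close> rules out \<open>n = 0\<close>,
          where the maximum is just \<open>f x\<close>. The other bound leaves a positive part above
          \<open>real i\<close> once \<open>f x\<close> is taken off, so this part is
          \<open>?F m (T x)\<close> itself.\<close>
        obtain i' :: nat where i': "real i + f x \<le> real i'" "f x \<le> real i'"
          using real_arch_simple[of "max (real i + f x) (f x)"] by auto
        obtain n where n: "real i' < ?F n x" using \<open>x \<in> A\<close> unfolding A_def by blast
        show ?thesis
        proof (cases n)
          case 0 then show ?thesis using n i' by simp
        next
          case (Suc m)
          then have "real i < max 0 (?F m (T x))" using n i' by simp
          then show ?thesis by (intro exI[of _ m]) (auto simp: max_def split: if_splits)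
        qed
      qed
      then show ?thesis using Tx unfolding A_def by auto
    qed
    moreover have "x \<in> A" if "T x \<in> A"
    proof -
      have "\<exists>n. real i < ?F n x" for i
      proof -
        obtain i' :: nat where i': "real i - f x \<le> real i'"
          using real_arch_simple by blast
        obtain n where "real i' < ?F n (T x)" using \<open>T x \<in> A\<close> unfolding A_def by blast
        then have "real i < ?F (Suc n) x" using i' by simp
        then show ?thesis by blast
      qed
      then show ?thesis using x unfolding A_def by auto
    qed
    ultimately show ?thesis by blast
  qed
  have "A \<in> null_sets M \<or> space M - A \<in> null_sets M"
    by (rule erg[OF A]) (use inv sets.sets_into_space[OF A] in auto)
  moreover have "space M - A \<notin> null_sets M"
  proof
    assume null: "space M - A \<in> null_sets M"
    \<comment> \<open>\<open>u n\<close> is the negative part of \<open>?F n\<close> after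
      \<open>T\<close>, which is exactly what the \<open>max 0\<close> in the recursion adds. It is
      at most \<open>C\<close> because \<open>?F n\<close> is at least \<open>f\<close>, and on
      \<open>A\<close> it vanishes from some \<open>n\<close> on.\<close>
    define u where "u = (\<lambda>n x. max 0 (- ?F n (T x)))"
    have u: "?F (Suc n) x = ?F n (T x) + (f x + u n x)" for n x
      by (simp add: u_def max_def)
    have [measurable]: "u n \<in> borel_measurable M" for n unfolding u_def by measurable
    have "0 \<le> C" using C[of undefined] by linarith
    have u_bd: "\<bar>u n x\<bar> \<le> C" for n x
    proof -
      have "f (T x) \<le> ?F n (T x)" using birkhoff_max_mono[of 0 n T f "T x"] by simp
      then show ?thesis using C[of "T x"] \<open>0 \<le> C\<close> by (auto simp: u_def)
    qed
    have intF: "integrable M (?F n)" for n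
      by (rule integrable_const_bound[where B = "of_nat (Suc n) * C"])
         (use birkhoff_max_bound[of f C] C in auto)
    have intFT: "integrable M (\<lambda>x. ?F n (T x))" for n
      by (rule integrable_const_bound[where B = "of_nat (Suc n) * C"])
         (use birkhoff_max_bound[of f C] C in auto)
    have intf: "integrable M f" by (rule integrable_const_bound[where B = C]) (use C in auto)
    have intu: "integrable M (u n)" for n
      by (rule integrable_const_bound[where B = C]) (use u_bd in auto)
    have nonneg: "0 \<le> (\<integral>x. f x + u n x \<partial>M)" for n
    proof -
      have "(\<integral>x. ?F n (T x) \<partial>M) = (\<integral>x. ?F n x \<partial>distr M M T)"
        by (rule integral_distr[symmetric]) measurable
      then have eq: "(\<integral>x. ?F n (T x) \<partial>M) = (\<integral>x. ?F n x \<partial>M)" by (simp only: TM)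
      have "(\<integral>x. ?F n x \<partial>M) \<le> (\<integral>x. ?F (Suc n) x \<partial>M)"
        by (rule integral_mono[OF intF intF]) (rule birkhoff_max_mono_Suc)
      also have "\<dots> = (\<integral>x. ?F n (T x) + (f x + u n x) \<partial>M)" by (simp only: u)
      also have "\<dots> = (\<integral>x. ?F n (T x) \<partial>M) + (\<integral>x. f x + u n x \<partial>M)"
        by (intro Bochner_Integration.integral_add intFT Bochner_Integration.integrable_add intf intu)
      finally show ?thesis using eq by simp
    qed
    have "(\<lambda>n. \<integral>x. f x + u n x \<partial>M) \<longlonglongrightarrow> (\<integral>x. f x \<partial>M)"
    proof (rule integral_dominated_convergence[where w = "\<lambda>_. 2 * C"])
      have "AE x in M. x \<in> A"
        using null by (intro AE_I'[OF null]) auto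
      then show "AE x in M. (\<lambda>n. f x + u n x) \<longlonglongrightarrow> f x"
      proof eventually_elim
        case (elim x)
        then have "T x \<in> A" using inv in_A by blast
        then have "filterlim (\<lambda>n. ?F n (T x)) at_top sequentially" using in_A by blast
        then have "eventually (\<lambda>n. 0 \<le> ?F n (T x)) sequentially"
          unfolding filterlim_at_top by blast
        then have "eventually (\<lambda>n. f x + u n x = f x) sequentially"
          by eventually_elim (simp add: u_def)
        then show ?case by (rule tendsto_eventually)
      qed
      show "AE x in M. norm (f x + u n x) \<le> 2 * C" for n
      proof (rule AE_I2)
        fix x show "norm (f x + u n x) \<le> 2 * C" using C[of x] u_bd[of n x] by simp
      qed
    qed auto
    then have "0 \<le> (\<integral>x. f x \<partial>M)"
      by (rule LIMSEQ_le_const) (use nonneg in auto)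
    with neg show False by simp
  qed
  ultimately have "AE x in M. x \<notin> A" by (auto intro: AE_not_in)
  then show ?thesis using AE_space
  proof eventually_elim
    case (elim x)
    then obtain i :: nat where i: "\<And>n. ?F n x \<le> real i" by (auto simp: A_def not_less)
    \<comment> \<open>The maximum starts with one summand, so the empty sum is treated apart; it is
      0 and thus below \<open>real i\<close>.\<close>
    have "birkhoff_sum T f n x \<le> real i" for n
    proof (cases n)
      case (Suc m)
      then show ?thesis using birkhoff_sum_le_max[of T f m x] i[of m] by simp
    qed simp
    then show ?case by blast
  qed
qed

text \<open>Subtracting \<open>1 / real (Suc m)\<close> makes the integral negative, so the sums of
  the shifted function are bounded above and those of \<open>f\<close> grow at most like
  \<open>n / (m + 1)\<close>. This for all \<open>m\<close>, and for \<open>- f\<close> as well,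
  gives the limit. The bound \<open>B\<close> depends on the point and on \<open>m\<close>, but is
  lost on division by \<open>n\<close>.\<close>

lemma AE_birkhoff_average_tendsto_0:
  fixes f :: "'a \<Rightarrow> real"
  assumes "prob_space M" "ergodic_map M T"
    and [measurable]: "f \<in> borel_measurable M" and C: "\<And>x. \<bar>f x\<bar> \<le> C"
    and zero: "(\<integral>x. f x \<partial>M) = 0"
  shows "AE x in M. (\<lambda>n. birkhoff_sum T f n x / real n) \<longlonglongrightarrow> 0"
proof -
  interpret prob_space M by fact
  have intf: "integrable M f" by (rule integrable_const_bound[where B = C]) (use C in auto)
  have *: "AE x in M. \<forall>m. \<exists>B. \<forall>n. birkhoff_sum T g n x \<le> B + real n / real (Suc m)"
    if [measurable]: "g \<in> borel_measurable M" and gC: "\<And>x. \<bar>g x\<bar> \<le> C" and "(\<integral>x. g x \<partial>M) = 0" for g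
    unfolding AE_all_countable
  proof
    fix m
    have intg: "integrable M g" by (rule integrable_const_bound[where B = C]) (use gC in auto)
    have "AE x in M. \<exists>B. \<forall>n. birkhoff_sum T (\<lambda>x. g x - 1 / real (Suc m)) n x \<le> B"
    proof (rule AE_birkhoff_sum_bdd_above[OF assms(1,2), where C = "C + 1"])
      fix x
      have "0 \<le> 1 / real (Suc m)" "1 / real (Suc m) \<le> 1" by auto
      then show "\<bar>g x - 1 / real (Suc m)\<bar> \<le> C + 1" using gC[of x] by linarith
    next
      show "(\<integral>x. g x - 1 / real (Suc m) \<partial>M) < 0"
        using that intg by (simp add: prob_space)
    qed measurable
    then show "AE x in M. \<exists>B. \<forall>n. birkhoff_sum T g n x \<le> B + real n / real (Suc m)"
      by eventually_elim (auto simp: birkhoff_sum_diff_const diff_le_eq)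
  qed
  have "AE x in M. \<forall>m. \<exists>B. \<forall>n. birkhoff_sum T f n x \<le> B + real n / real (Suc m)"
    by (rule *) (use C zero in auto)
  moreover have "AE x in M. \<forall>m. \<exists>B. \<forall>n. birkhoff_sum T (\<lambda>x. - f x) n x \<le> B + real n / real (Suc m)"
    by (rule *) (use C zero in auto)
  ultimately show ?thesis
  proof eventually_elim
    case (elim x)
    show ?case
    proof (rule LIMSEQ_I)
      fix e :: real assume "0 < e"
      then obtain m where m: "1 / real (Suc m) < e / 2"
        using nat_approx_posE[of "e / 2"] by auto
      obtain B1 where B1: "\<And>n. birkhoff_sum T f n x \<le> B1 + real n / real (Suc m)"
        using elim(1) by blast
      obtain B2 where B2: "\<And>n. - birkhoff_sum T f n x \<le> B2 + real n / real (Suc m)"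
        using elim(2) by (auto simp: birkhoff_sum_uminus)
      define B where "B = max B1 B2"
      have B: "\<bar>birkhoff_sum T f n x\<bar> \<le> B + real n / real (Suc m)" for n
        using B1[of n] B2[of n] by (auto simp: B_def abs_if max_def)
      obtain n0 :: nat where n0: "2 * \<bar>B\<bar> / e < real n0" using reals_Archimedean2 by blast
      show "\<exists>no. \<forall>n\<ge>no. norm (birkhoff_sum T f n x / real n - 0) < e"
      proof (intro exI allI impI)
        fix n assume n: "Suc n0 \<le> n"
        have "2 * \<bar>B\<bar> / e < real n" using n0 n by linarith
        then have "\<bar>B\<bar> < real n * (e / 2)" using \<open>0 < e\<close> by (simp add: field_simps)
        moreover have "real n / real (Suc m) < real n * (e / 2)"
          using m n by (metis divide_inverse mult_1 mult_strict_left_mono of_nat_0_less_iff less_le_trans zero_less_Suc)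
        ultimately have "\<bar>birkhoff_sum T f n x\<bar> < real n * e"
          using B[of n] by linarith
        then show "norm (birkhoff_sum T f n x / real n - 0) < e"
          using n by (simp add: field_simps)
      qed
    qed
  qed
qed

text \<open>The averages are bounded by \<open>C\<close>, so dominated convergence applies to the
  almost everywhere limit.\<close>

lemma birkhoff_average_tendsto_0_L1:
  fixes f :: "'a \<Rightarrow> real"
  assumes "prob_space M" "ergodic_map M T"
    and [measurable]: "f \<in> borel_measurable M" and C: "\<And>x. \<bar>f x\<bar> \<le> C"
    and zero: "(\<integral>x. f x \<partial>M) = 0"
  shows "(\<lambda>n. \<integral>x. \<bar>birkhoff_sum T f n x / real n\<bar> \<partial>M) \<longlonglongrightarrow> 0"
proof -
  interpret prob_space M by fact
  have [measurable]: "T \<in> M \<rightarrow>\<^sub>M M"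
    using assms(2) unfolding ergodic_map_def measure_preserving_map_def by auto
  have "0 \<le> C" using C[of undefined] by linarith
  have "(\<lambda>n. \<integral>x. \<bar>birkhoff_sum T f n x / real n\<bar> \<partial>M) \<longlonglongrightarrow> (\<integral>x. 0 \<partial>M)"
  proof (rule integral_dominated_convergence[where w = "\<lambda>_. C"])
    show "AE x in M. (\<lambda>n. \<bar>birkhoff_sum T f n x / real n\<bar>) \<longlonglongrightarrow> 0"
      using AE_birkhoff_average_tendsto_0[OF assms] by eventually_elim (rule tendsto_rabs_zero)
    show "AE x in M. norm \<bar>birkhoff_sum T f n x / real n\<bar> \<le> C" for n
      using birkhoff_sum_bound[of f C T n] C \<open>0 \<le> C\<close>
      by (cases n) (auto simp: field_simps)
  qed auto
  then show ?thesis by simp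
qed

section \<open>Long Birkhoff averages compared with averages over short blocks\<close>

text \<open>One application of \<open>T\<close> drops the first summand and appends a new last one,
  a change of at most \<open>2 * C\<close>; the changes from \<open>k\<close> applications add
  up.\<close>

lemma birkhoff_sum_funpow_diff_bound:
  fixes f :: "'a \<Rightarrow> real"
  assumes C: "\<And>x. \<bar>f x\<bar> \<le> C"
  shows "\<bar>birkhoff_sum T f N ((T ^^ k) x) - birkhoff_sum T f N x\<bar> \<le> 2 * real k * C"
proof (induction k)
  case (Suc k)
  let ?y = "(T ^^ k) x"
  have "birkhoff_sum T f N (T ?y) - birkhoff_sum T f N ?y = f ((T ^^ N) ?y) - f ?y"
    using birkhoff_sum_Suc[of T f N ?y] birkhoff_sum_Suc'[of T f N ?y] by linarith
  then have "\<bar>birkhoff_sum T f N (T ?y) - birkhoff_sum T f N ?y\<bar> \<le> 2 * C"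
    using C[of "(T ^^ N) ?y"] C[of ?y] by linarith
  then show ?case using Suc by (simp add: algebra_simps)
qed simp

text \<open>Both sides are the double sum of \<open>f ((T ^^ (n + k)) x)\<close> over
  \<open>n < N\<close> and \<open>k < K\<close>.\<close>

lemma birkhoff_sum_swap:
  "(\<Sum>n<N. birkhoff_sum T f K ((T ^^ n) x)) = (\<Sum>k<K. birkhoff_sum T f N ((T ^^ k) x))"
  unfolding birkhoff_sum_def
  by (subst sum.swap) (simp flip: funpow_add o_apply[of "T ^^ _" "T ^^ _"] add: add.commute)

text \<open>The sum of length \<open>N\<close> differs by at most \<open>2 * K * C\<close> from the
  mean of its translates under \<open>T ^^ k\<close> with \<open>k < K\<close>. By exchanging the
  sums, this mean is also a sum over \<open>n < N\<close> of block averages of length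
  \<open>K\<close>.\<close>

lemma birkhoff_sum_le_averaged:
  fixes f :: "'a \<Rightarrow> real"
  assumes C: "\<And>x. \<bar>f x\<bar> \<le> C" and K: "0 < K"
  shows "\<bar>birkhoff_sum T f N x\<bar> \<le>
    birkhoff_sum T (\<lambda>y. \<bar>birkhoff_sum T f K y / real K\<bar>) N x + 2 * real K * C"
proof -
  have "0 \<le> C" using C[of undefined] by linarith
  have "\<bar>(\<Sum>k<K. birkhoff_sum T f N ((T ^^ k) x)) - real K * birkhoff_sum T f N x\<bar>
      = \<bar>\<Sum>k<K. (birkhoff_sum T f N ((T ^^ k) x) - birkhoff_sum T f N x)\<bar>"
    by (simp add: sum_subtractf)
  also have "\<dots> \<le> (\<Sum>k<K. \<bar>birkhoff_sum T f N ((T ^^ k) x) - birkhoff_sum T f N x\<bar>)"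
    by (rule sum_abs)
  also have "\<dots> \<le> (\<Sum>k<K. 2 * real K * C)"
  proof (rule sum_mono)
    fix k assume "k \<in> {..<K}"
    then have "2 * real k * C \<le> 2 * real K * C" using \<open>0 \<le> C\<close> by (intro mult_right_mono) auto
    then show "\<bar>birkhoff_sum T f N ((T ^^ k) x) - birkhoff_sum T f N x\<bar> \<le> 2 * real K * C"
      using birkhoff_sum_funpow_diff_bound[of f C T N k x, OF C] by linarith
  qed
  also have "\<dots> = real K * (2 * real K * C)" by simp
  finally have "real K * \<bar>birkhoff_sum T f N x\<bar>
      \<le> \<bar>\<Sum>k<K. birkhoff_sum T f N ((T ^^ k) x)\<bar> + real K * (2 * real K * C)"
    using abs_mult[of "real K" "birkhoff_sum T f N x"] by linarith
  also have "\<bar>\<Sum>k<K. birkhoff_sum T f N ((T ^^ k) x)\<bar> \<le> (\<Sum>n<N. \<bar>birkhoff_sum T f K ((T ^^ n) x)\<bar>)"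
    unfolding birkhoff_sum_swap[symmetric] by (rule sum_abs)
  also have "(\<Sum>n<N. \<bar>birkhoff_sum T f K ((T ^^ n) x)\<bar>)
      = real K * birkhoff_sum T (\<lambda>y. \<bar>birkhoff_sum T f K y / real K\<bar>) N x"
    using K unfolding birkhoff_sum_def[of T "\<lambda>y. \<bar>birkhoff_sum T f K y / real K\<bar>"]
    by (simp add: sum_distrib_left)
  finally have "real K * \<bar>birkhoff_sum T f N x\<bar> \<le> real K *
      (birkhoff_sum T (\<lambda>y. \<bar>birkhoff_sum T f K y / real K\<bar>) N x + 2 * real K * C)"
    by (simp add: distrib_left)
  then show ?thesis using K by simp
qed

lemma continuous_on_funpow:
  fixes T :: "'a::topological_space \<Rightarrow> 'a"
  assumes "continuous_on UNIV T"
  shows "continuous_on UNIV (T ^^ n)"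
proof (induction n)
  case (Suc n)
  show ?case using continuous_on_compose2[OF assms Suc] by (simp add: o_def)
qed (simp add: id_def)

lemma continuous_on_birkhoff_sum:
  fixes f :: "'a::topological_space \<Rightarrow> real"
  assumes T: "continuous_on UNIV T" and f: "continuous_on UNIV f"
  shows "continuous_on UNIV (birkhoff_sum T f n)"
  unfolding birkhoff_sum_def[abs_def]
  by (intro continuous_on_sum continuous_on_compose2[OF f continuous_on_funpow[OF T]]) auto

section \<open>Approximation by compactly supported functions\<close>

lemma zero_outside_support: "x \<notin> closure {x. f x \<noteq> 0} \<Longrightarrow> f x = 0"
  using closure_subset[of "{x. f x \<noteq> 0}"] by blast

text \<open>Compact sets are closed in a Hausdorff space, which puts the support inside
  \<open>K\<close>. Membership in \<open>C_c\<close> can thus be checked with any convenient compact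
  set.\<close>

lemma C_c_subset_support:
  fixes f :: "'a::t2_space \<Rightarrow> real"
  assumes "continuous_on UNIV f" "compact K" "\<And>x. x \<notin> K \<Longrightarrow> f x = 0"
  shows "f \<in> C_c"
proof -
  have "closure {x. f x \<noteq> 0} \<subseteq> K"
    using assms by (intro closure_minimal compact_imp_closed) auto
  then have "compact (closure {x. f x \<noteq> 0})"
    using compact_Int_closed[OF assms(2) closed_closure[of "{x. f x \<noteq> 0}"]] by (simp add: Int_absorb1)
  with assms(1) show ?thesis by (simp add: C_c_def)
qed

lemma C_c_max:
  fixes f g :: "'a::t2_space \<Rightarrow> real"
  assumes f: "f \<in> C_c" and g: "g \<in> C_c"
  shows "(\<lambda>x. max (f x) (g x)) \<in> C_c"
proof (rule C_c_subset_support)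
  show "continuous_on UNIV (\<lambda>x. max (f x) (g x))"
    using assms unfolding C_c_def by (auto intro: continuous_on_max)
  show "compact (closure {x. f x \<noteq> 0} \<union> closure {x. g x \<noteq> 0})"
    using assms unfolding C_c_def by (auto intro: compact_Un)
  fix x assume "x \<notin> closure {x. f x \<noteq> 0} \<union> closure {x. g x \<noteq> 0}"
  then have "f x = 0" "g x = 0" by (auto dest: zero_outside_support)
  then show "max (f x) (g x) = 0" by simp
qed

lemma C_c_cmult:
  fixes f :: "'a::t2_space \<Rightarrow> real"
  assumes f: "f \<in> C_c"
  shows "(\<lambda>x. c * f x) \<in> C_c"
proof (rule C_c_subset_support)
  show "continuous_on UNIV (\<lambda>x. c * f x)"
    using assms unfolding C_c_def by (auto intro: continuous_on_mult_left)
  show "compact (closure {x. f x \<noteq> 0})"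
    using assms unfolding C_c_def by auto
  fix x assume "x \<notin> closure {x. f x \<noteq> 0}"
  then have "f x = 0" by (rule zero_outside_support)
  then show "c * f x = 0" by simp
qed

lemma C_c_zero: "(\<lambda>_. 0) \<in> C_c"
  by (simp add: C_c_def)

lemma C_c_bounded:
  fixes f :: "'a::topological_space \<Rightarrow> real"
  assumes "f \<in> C_c"
  obtains C where "\<And>x. \<bar>f x\<bar> \<le> C"
proof -
  let ?K = "closure {x. f x \<noteq> 0}"
  have "compact (f ` ?K)"
    using assms unfolding C_c_def by (auto intro: compact_continuous_image continuous_on_subset)
  then obtain B where B: "\<And>y. y \<in> f ` ?K \<Longrightarrow> \<bar>y\<bar> \<le> B"
    using compact_imp_bounded[of "f ` ?K"] by (auto simp: bounded_real)
  \<comment> \<open>\<open>B\<close> bounds \<open>f\<close> on its support only and may be negative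
    if that is empty; 0 accounts for the points where \<open>f\<close> vanishes.\<close>
  have "\<bar>f x\<bar> \<le> max B 0" for x
  proof (cases "f x = 0")
    case False
    then have "f x \<in> f ` ?K" using closure_subset by fastforce
    then show ?thesis using B by fastforce
  qed simp
  then show ?thesis by (rule that)
qed

text \<open>A locally compact Hausdorff space is completely regular, so \<open>x\<close> can be
  separated from the closed complement of \<open>U \<inter> V\<close>, where \<open>V\<close> is a
  neighbourhood of \<open>x\<close> inside a compact \<open>K\<close>. Vanishing off
  \<open>V\<close> forces compact support.\<close>

lemma exists_C_c_bump:
  fixes x :: "'a::t2_space"
  assumes lc: "locally_compact_space (euclidean :: 'a topology)"
    and "open U" "x \<in> U"
  obtains f :: "'a \<Rightarrow> real" where "f \<in> C_c" "range f \<subseteq> {0..1}" "f x = 1" "\<And>y. y \<notin> U \<Longrightarrow> f y = 0"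
proof -
  have haus: "Hausdorff_space (euclidean :: 'a topology)"
    unfolding Hausdorff_space_def disjnt_def using hausdorff by (metis (no_types, lifting) open_openin)
  have "completely_regular_space (euclidean :: 'a topology)"
    using lc haus locally_compact_Hausdorff_imp_regular_space
      locally_compact_regular_imp_completely_regular_space by blast
  moreover obtain V K where VK: "open V" "compact K" "x \<in> V" "V \<subseteq> K"
    using lc unfolding locally_compact_space_def by simp blast
  moreover have "closed (- (U \<inter> V))" using assms VK by auto
  ultimately obtain g :: "'a \<Rightarrow> real"
    where g: "continuous_map euclidean (top_of_set {0..1}) g" "g x = 0" "g ` (- (U \<inter> V)) \<subseteq> {1}"
    using assms unfolding completely_regular_space_def
    by (metis Compl_iff Diff_iff IntI UNIV_I closed_closedin topspace_euclidean)
  have g1: "continuous_on UNIV g" "\<And>y. 0 \<le> g y \<and> g y \<le> 1"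
    using g(1) by (auto simp: continuous_map_in_subtopology image_subset_iff Pi_iff)
  have g0: "g y = 1" if "y \<notin> U \<inter> V" for y
    using g(3) that by (metis ComplI image_subset_iff singletonD)
  show ?thesis
  proof
    show "(\<lambda>y. 1 - g y) \<in> C_c"
    proof (rule C_c_subset_support)
      show "continuous_on UNIV (\<lambda>y. 1 - g y)" by (intro continuous_on_diff continuous_on_const g1)
      show "1 - g y = 0" if "y \<notin> K" for y using g0[of y] that VK by auto
    qed (rule VK)
    show "range (\<lambda>y. 1 - g y) \<subseteq> {0..1}" using g1(2) by auto
    show "1 - g x = 1" by (simp add: g)
    show "1 - g y = 0" if "y \<notin> U" for y using g0[of y] that by auto
  qed
qed

text \<open>One function is selected for each pair of basic sets \<open>V\<close>, \<open>W\<close>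
  that admits a function equal to 1 on \<open>V\<close> and 0 off \<open>W\<close>; there are only
  countably many pairs. A small \<open>W\<close> and then a small enough \<open>V\<close> around
  \<open>x\<close> always form such a pair.\<close>

lemma countable_C_c_bumps:
  assumes lc: "locally_compact_space (euclidean :: 'a topology)"
  obtains b :: "nat \<Rightarrow> 'a::{t2_space, second_countable_topology} \<Rightarrow> real"
  where "\<And>i. b i \<in> C_c" "\<And>i. range (b i) \<subseteq> {0..1}"
    "\<And>x U. open U \<Longrightarrow> x \<in> U \<Longrightarrow> \<exists>i. b i x = 1 \<and> (\<forall>y. y \<notin> U \<longrightarrow> b i y = 0)"
proof -
  obtain B :: "'a set set" where B: "countable B" "topological_basis B"
    using ex_countable_basis by blast
  define P where "P = (\<lambda>V W (f :: 'a \<Rightarrow> real).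
    f \<in> C_c \<and> range f \<subseteq> {0..1} \<and> (\<forall>x\<in>V. f x = 1) \<and> (\<forall>y. y \<notin> W \<longrightarrow> f y = 0))"
  \<comment> \<open>The zero function keeps \<open>F\<close> nonempty, so that
    \<open>from_nat_into F\<close> is onto \<open>F\<close>.\<close>
  define F where "F = insert (\<lambda>_. 0) ((\<lambda>(V, W). SOME f. P V W f) ` {(V, W) \<in> B \<times> B. \<exists>f. P V W f})"
  have "countable F"
    unfolding F_def using B(1)
    by (intro countable_insert countable_image) (rule countable_subset[of _ "B \<times> B"], auto)
  then have range_F: "range (from_nat_into F) = F"
    by (rule range_from_nat_into[rotated]) (simp add: F_def)
  have F: "f \<in> C_c \<and> range f \<subseteq> {0..1}" if "f \<in> F" for f
  proof -
    consider "f = (\<lambda>_. 0)" | V W g where "P V W g" "f = (SOME f. P V W f)"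
      using \<open>f \<in> F\<close> unfolding F_def by auto
    then show ?thesis
    proof cases
      case 1 then show ?thesis by (auto simp: C_c_zero)
    next
      case 2 then have "P V W f" by (metis someI_ex)
      then show ?thesis by (simp add: P_def)
    qed
  qed
  show ?thesis
  proof
    show "from_nat_into F i \<in> C_c" "range (from_nat_into F i) \<subseteq> {0..1}" for i
      using F range_F by (metis rangeI)+
    fix x :: 'a and U assume "open U" "x \<in> U"
    then obtain W where W: "W \<in> B" "x \<in> W" "W \<subseteq> U"
      using B(2) by (metis topological_basisE)
    have "open W" using W(1) B(2) topological_basis_open by blast
    then obtain f :: "'a \<Rightarrow> real"
      where f: "f \<in> C_c" "range f \<subseteq> {0..1}" "f x = 1" "\<And>y. y \<notin> W \<Longrightarrow> f y = 0"
      using exists_C_c_bump[OF lc _ W(2)] by blast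
    have contf: "continuous_on UNIV f" using f(1) by (simp add: C_c_def)
    \<comment> \<open>\<open>f\<close> is known to be 1 only at \<open>x\<close>. Doubling and
      truncating gives 1 on the whole open set where \<open>f\<close> exceeds 1/2, and this set
      contains a basic \<open>V\<close>.\<close>
    have "open {y. 1 / 2 < f y}"
      using contf by (intro open_Collect_less) auto
    then obtain V where V: "V \<in> B" "x \<in> V" "V \<subseteq> {y. 1 / 2 < f y}"
      using B(2) f(3) topological_basisE[of B "{y. 1 / 2 < f y}" x] by auto
    have "P V W (\<lambda>y. min 1 (2 * f y))"
      unfolding P_def
    proof (intro conjI ballI allI impI)
      show "(\<lambda>y. min 1 (2 * f y)) \<in> C_c"
      proof (rule C_c_subset_support)
        show "continuous_on UNIV (\<lambda>y. min 1 (2 * f y))" by (intro continuous_on_min continuous_on_mult_left continuous_on_const contf)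
        show "compact (closure {y. f y \<noteq> 0})" using f(1) by (simp add: C_c_def)
        fix y assume "y \<notin> closure {y. f y \<noteq> 0}"
        then have "f y = 0" by (rule zero_outside_support)
        then show "min 1 (2 * f y) = 0" by simp
      qed
      have "0 \<le> f y" for y using f(2) by (auto simp: image_subset_iff)
      then show "range (\<lambda>y. min 1 (2 * f y)) \<subseteq> {0..1}" by auto
      show "min 1 (2 * f y) = 1" if "y \<in> V" for y using V(3) that by (auto simp: min_def)
      show "min 1 (2 * f y) = 0" if "y \<notin> W" for y using f(4)[OF that] by simp
    qed
    then have ex: "\<exists>f. P V W f" by blast
    then have "P V W (SOME f. P V W f)" by (rule someI_ex)
    moreover have "(SOME f. P V W f) \<in> F" using V W ex by (auto simp: F_def)
    ultimately obtain i where "P V W (from_nat_into F i)" using range_F by (metis imageE)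
    then show "\<exists>i. from_nat_into F i x = 1 \<and> (\<forall>y. y \<notin> U \<longrightarrow> from_nat_into F i y = 0)"
      using V(2) W(3) unfolding P_def by blast
  qed
qed

text \<open>The approximants are finite maxima of rational multiples of bumps.\<close>

lemma countable_C_c_approx_from_below:
  assumes lc: "locally_compact_space (euclidean :: 'a topology)"
  obtains \<Phi> :: "nat \<Rightarrow> 'a::{t2_space, second_countable_topology} \<Rightarrow> real"
  where "\<And>i. \<Phi> i \<in> C_c" "\<And>i x. 0 \<le> \<Phi> i x"
    "\<And>\<psi>. continuous_on UNIV \<psi> \<Longrightarrow> (\<And>x. 0 \<le> \<psi> x) \<Longrightarrow>
       \<exists>s. (\<forall>j x. \<Phi> (s j) x \<le> \<psi> x) \<and> (\<forall>x. (\<lambda>j. \<Phi> (s j) x) \<longlonglongrightarrow> \<psi> x)"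
proof -
  obtain b :: "nat \<Rightarrow> 'a \<Rightarrow> real"
    where b: "\<And>i. b i \<in> C_c" "\<And>i. range (b i) \<subseteq> {0..1}"
      "\<And>x U. open U \<Longrightarrow> x \<in> U \<Longrightarrow> \<exists>i. b i x = 1 \<and> (\<forall>y. y \<notin> U \<longrightarrow> b i y = 0)"
    using countable_C_c_bumps[OF lc] by blast
  have b01: "0 \<le> b i x" "b i x \<le> 1" for i x using b(2)[of i] by (auto simp: image_subset_iff)
  \<comment> \<open>The fold starts from 0, so \<open>S l\<close> is nonnegative even if some
    coefficients are negative. Lists of pairs of rationals and indices form a countable type, so
    \<open>from_nat\<close> reaches every \<open>S l\<close>.\<close>
  define S where "S = (\<lambda>(l :: (rat \<times> nat) list) x. foldr (\<lambda>(q, i) r. max (of_rat q * b i x) r) l 0)"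
  have S_Nil: "S [] x = 0" for x by (simp add: S_def)
  have S_Cons: "S ((q, i) # l) x = max (of_rat q * b i x) (S l x)" for q i l x by (simp add: S_def)
  have S_nonneg: "0 \<le> S l x" for l x
    by (induction l) (auto simp: S_Nil S_Cons)
  have S_C_c: "S l \<in> C_c" for l
  proof (induction l)
    case (Cons a l)
    obtain q i where a: "a = (q, i)" by fastforce
    have "S (a # l) = (\<lambda>x. max (of_rat q * b i x) (S l x))" by (auto simp: a S_Cons fun_eq_iff)
    then show ?case using Cons b(1) C_c_max C_c_cmult by metis
  next
    case Nil
    have "S [] = (\<lambda>_. 0)" by (simp add: fun_eq_iff S_Nil)
    then show ?case by (simp add: C_c_zero)
  qed
  have S_ge: "of_rat q * b i x \<le> S l x" if "(q, i) \<in> set l" for q i l x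
    using that by (induction l) (auto simp: S_Cons le_max_iff_disj)
  have S_le: "S l x \<le> c" if "0 \<le> c" "\<And>q i. (q, i) \<in> set l \<Longrightarrow> of_rat q * b i x \<le> c" for l x c
    using that(2) by (induction l) (auto simp: S_Nil S_Cons that(1))
  show ?thesis
  proof
    show "S (from_nat i) \<in> C_c" "0 \<le> S (from_nat i) x" for i x
      by (simp_all add: S_C_c S_nonneg)
    fix \<psi> :: "'a \<Rightarrow> real"
    assume \<psi>: "continuous_on UNIV \<psi>" "\<And>x. 0 \<le> \<psi> x"
    \<comment> \<open>\<open>Q\<close> collects all rational multiples of bumps lying below
      \<open>\<psi>\<close>; the approximants are the maxima over its first \<open>j\<close> members
      in an enumeration.\<close>
    define Q where "Q = {(q :: rat, i). \<forall>y. of_rat q * b i y \<le> \<psi> y}"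
    have "(0, 0) \<in> Q" using \<psi>(2) by (simp add: Q_def)
    then have rQ: "range (from_nat_into Q) = Q"
      by (intro range_from_nat_into) auto
    define l where "l = (\<lambda>j. map (from_nat_into Q) [0..<j])"
    have set_l: "set (l j) \<subseteq> Q" for j using rQ by (auto simp: l_def)
    have le: "S (l j) x \<le> \<psi> x" for j x
      by (rule S_le) (use \<psi>(2) set_l in \<open>auto simp: Q_def\<close>)
    have lim: "(\<lambda>j. S (l j) x) \<longlonglongrightarrow> \<psi> x" for x
    proof (rule order_tendstoI)
      fix a assume "a < \<psi> x"
      then obtain q :: rat where q: "a < of_rat q" "of_rat q < \<psi> x" using of_rat_dense by blast
      show "eventually (\<lambda>j. a < S (l j) x) sequentially"
      \<comment> \<open>If \<open>q\<close> is negative, so is \<open>a\<close>, and nonnegativity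
        of \<open>S\<close> suffices. Otherwise a bump at \<open>x\<close> that vanishes where
        \<open>\<psi>\<close> is at most \<open>q\<close> stays below \<open>\<psi>\<close> after
        multiplication by \<open>q\<close>, and it lifts \<open>S\<close> at \<open>x\<close> above
        \<open>a\<close>.\<close>
      proof (cases "q < 0")
        case True
        then have "a < 0" using q by (metis less_trans of_rat_less_0_iff)
        then show ?thesis using S_nonneg by (intro always_eventually) (auto intro: less_le_trans)
      next
        case False
        have "open {y. of_rat q < \<psi> y}" using \<psi>(1) by (intro open_Collect_less) auto
        then obtain i where i: "b i x = 1" "\<And>y. \<not> of_rat q < \<psi> y \<Longrightarrow> b i y = 0"
          using b(3)[of "{y. of_rat q < \<psi> y}" x] q by auto
        have "of_rat q * b i y \<le> \<psi> y" for y
        proof (cases "of_rat q < \<psi> y")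
          case True
          have "of_rat q * b i y \<le> of_rat q" using False b01[of i y] by (simp add: mult_left_le)
          then show ?thesis using True by linarith
        qed (use i(2) \<psi>(2) in auto)
        then have "(q, i) \<in> Q" by (simp add: Q_def)
        then obtain k where k: "from_nat_into Q k = (q, i)" using rQ by (metis imageE)
        have "a < S (l j) x" if "Suc k \<le> j" for j
        proof -
          have "from_nat_into Q k \<in> set (l j)"
            unfolding l_def set_map using that by (intro imageI) simp
          then have "(q, i) \<in> set (l j)" using k by simp
          then have "of_rat q \<le> S (l j) x" using S_ge[of q i "l j" x] i by simp
          then show ?thesis using q by linarith
        qed
        then show ?thesis unfolding eventually_sequentially by blast
      qed
    next
      fix a assume "\<psi> x < a"
      then show "eventually (\<lambda>j. S (l j) x < a) sequentially"
        using le by (intro always_eventually) (auto intro: le_less_trans)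
    qed
    show "\<exists>s. (\<forall>j x. S (from_nat (s j)) x \<le> \<psi> x) \<and> (\<forall>x. (\<lambda>j. S (from_nat (s j)) x) \<longlonglongrightarrow> \<psi> x)"
      by (rule exI[of _ "\<lambda>j. to_nat (l j)"]) (simp add: le lim)
  qed
qed

section \<open>Convergence of integrals of bounded continuous functions\<close>

text \<open>Approximation from below bounds the limit inferior of the integrals of a nonnegative
  function from below. As the measures eventually have mass 1, this applies to
  \<open>C + \<psi>\<close> and \<open>C - \<psi>\<close> and yields both inequalities. The filter
  is arbitrary so that limits along a set of indices are covered too.\<close>

lemma tendsto_integral_of_approx_from_below:
  fixes \<Phi> :: "nat \<Rightarrow> 'a::topological_space \<Rightarrow> real" and M :: "'i \<Rightarrow> 'a measure"
    and \<psi> :: "'a \<Rightarrow> real"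
  assumes \<Phi>: "\<And>k. \<Phi> k \<in> C_c" "\<And>k x. 0 \<le> \<Phi> k x"
    and approx: "\<And>\<psi>. continuous_on UNIV \<psi> \<Longrightarrow> (\<And>x. 0 \<le> \<psi> x) \<Longrightarrow>
      \<exists>s. (\<forall>j x. \<Phi> (s j) x \<le> \<psi> x) \<and> (\<forall>x. (\<lambda>j. \<Phi> (s j) x) \<longlonglongrightarrow> \<psi> x)"
    and \<mu>: "prob_space \<mu>" "sets \<mu> = sets borel"
    and M: "eventually (\<lambda>i. prob_space (M i) \<and> sets (M i) = sets borel) F"
    and lim: "\<And>k. ((\<lambda>i. \<integral>x. \<Phi> k x \<partial>M i) \<longlongrightarrow> (\<integral>x. \<Phi> k x \<partial>\<mu>)) F"
    and \<psi>: "continuous_on UNIV \<psi>" "\<And>x. \<bar>\<psi> x\<bar> \<le> C"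
  shows "((\<lambda>i. \<integral>x. \<psi> x \<partial>M i) \<longlongrightarrow> (\<integral>x. \<psi> x \<partial>\<mu>)) F"
proof -
  have integrable: "integrable N f"
    if N: "prob_space N" "sets N = sets borel"
      and f: "continuous_on UNIV f" "\<And>x. \<bar>f x\<bar> \<le> B" for N :: "'a measure" and f :: "'a \<Rightarrow> real" and B
  proof -
    interpret N: prob_space N by fact
    have "f \<in> borel_measurable N"
      using borel_measurable_continuous_onI[OF f(1)] N(2) by (simp cong: measurable_cong_sets)
    then show ?thesis by (rule N.integrable_const_bound[where B = B, rotated]) (use f(2) in auto)
  qed
  have contM: "continuous_on UNIV (\<Phi> k)" for k using \<Phi>(1)[of k] by (simp add: C_c_def)
  have lower: "eventually (\<lambda>i. a < (\<integral>x. f x \<partial>M i)) F"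
    if f: "continuous_on UNIV f" "\<And>x. 0 \<le> f x" "\<And>x. f x \<le> B" and a: "a < (\<integral>x. f x \<partial>\<mu>)" for f :: "'a \<Rightarrow> real" and a B
  proof -
    have fB: "\<bar>f x\<bar> \<le> B" for x using f(2,3)[of x] by simp
    obtain s where s: "\<And>j x. \<Phi> (s j) x \<le> f x" "\<And>x. (\<lambda>j. \<Phi> (s j) x) \<longlonglongrightarrow> f x"
      using approx[OF f(1,2)] by blast
    have sB: "\<bar>\<Phi> (s j) x\<bar> \<le> B" for j x using \<Phi>(2)[of "s j" x] s(1)[of j x] f(3)[of x] by linarith
    interpret \<mu>: prob_space \<mu> by fact
    have "(\<lambda>j. \<integral>x. \<Phi> (s j) x \<partial>\<mu>) \<longlonglongrightarrow> (\<integral>x. f x \<partial>\<mu>)"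
    proof (rule integral_dominated_convergence[where w = "\<lambda>_. B"])
      show "f \<in> borel_measurable \<mu>" using integrable[OF \<mu> f(1) fB] by auto
      show "\<Phi> (s j) \<in> borel_measurable \<mu>" for j using integrable[OF \<mu> contM sB] by auto
    qed (use s(2) sB in auto)
    then have "eventually (\<lambda>j. a < (\<integral>x. \<Phi> (s j) x \<partial>\<mu>)) sequentially"
      using a by (rule order_tendstoD(1))
    \<comment> \<open>A single approximant whose integral under \<open>\<mu>\<close> exceeds
      \<open>a\<close> is enough: its integrals under \<open>M i\<close> converge, and those of
      \<open>f\<close> are at least as large.\<close>
    then obtain j where "a < (\<integral>x. \<Phi> (s j) x \<partial>\<mu>)"
      by (auto dest: eventually_happens)
    then have "eventually (\<lambda>i. a < (\<integral>x. \<Phi> (s j) x \<partial>M i)) F"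
      using lim[of "s j"] by (rule order_tendstoD(1)[rotated])
    then show ?thesis using M
    proof eventually_elim
      case (elim i)
      have "(\<integral>x. \<Phi> (s j) x \<partial>M i) \<le> (\<integral>x. f x \<partial>M i)"
        using elim(2) s(1)
        by (intro integral_mono integrable[OF _ _ contM sB] integrable[OF _ _ f(1) fB]) auto
      then show ?case using elim by simp
    qed
  qed
  have shift: "(\<integral>x. C + f x \<partial>N) = C + (\<integral>x. f x \<partial>N)"
    if "prob_space N" "sets N = sets borel" "continuous_on UNIV f" "\<And>x. \<bar>f x\<bar> \<le> C" for N :: "'a measure" and f :: "'a \<Rightarrow> real"
  proof -
    interpret N: prob_space N by fact
    show ?thesis using integrable[OF that] by (simp add: N.prob_space)
  qed
  have \<psi>2: "0 \<le> C + \<psi> x" "C + \<psi> x \<le> 2 * C" "0 \<le> C + - \<psi> x" "C + - \<psi> x \<le> 2 * C" for x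
    using \<psi>(2)[of x] by auto
  have n\<psi>: "continuous_on UNIV (\<lambda>x. - \<psi> x)" "\<And>x. \<bar>- \<psi> x\<bar> \<le> C"
    using \<psi> by (auto intro: continuous_on_minus)
  show ?thesis
  proof (rule order_tendstoI)
    fix a assume "a < (\<integral>x. \<psi> x \<partial>\<mu>)"
    then have "C + a < (\<integral>x. C + \<psi> x \<partial>\<mu>)" using shift[OF \<mu> \<psi>] by simp
    then have "eventually (\<lambda>i. C + a < (\<integral>x. C + \<psi> x \<partial>M i)) F"
      by (rule lower[of "\<lambda>x. C + \<psi> x" "2 * C", rotated 3]) (use \<psi>2 in \<open>auto intro!: continuous_on_add continuous_on_const \<psi>\<close>)
    then show "eventually (\<lambda>i. a < (\<integral>x. \<psi> x \<partial>M i)) F"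
      using M by eventually_elim (use shift \<psi> in auto)
  next
    fix a assume "(\<integral>x. \<psi> x \<partial>\<mu>) < a"
    then have "C - a < (\<integral>x. C + - \<psi> x \<partial>\<mu>)" using shift[OF \<mu> n\<psi>] by simp
    then have "eventually (\<lambda>i. C - a < (\<integral>x. C + - \<psi> x \<partial>M i)) F"
      by (rule lower[of "\<lambda>x. C + - \<psi> x" "2 * C", rotated 3]) (use \<psi>2 in \<open>auto intro!: continuous_on_diff continuous_on_const \<psi>\<close>)
    then show "eventually (\<lambda>i. (\<integral>x. \<psi> x \<partial>M i) < a) F"
      using M
    proof eventually_elim
      case (elim i)
      then show ?case using shift[of "M i", OF _ _ n\<psi>] by simp
    qed
  qed
qed

section \<open>Cesaro averages of a measure\<close>

text \<open>The Cesaro measure is the law of \<open>(T ^^ n) x\<close> for \<open>x\<close> drawn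
  from \<open>\<nu>\<close> and \<open>n\<close> uniform on \<open>{..<N}\<close>. Writing it as a
  bind gives its mass and its integrals from those of the pushforwards.\<close>

lemma cesaro_measure_eq_bind:
  assumes [measurable]: "T \<in> borel_measurable borel" and "prob_space \<nu>" and \<nu>: "sets \<nu> = sets borel" and "0 < N"
  shows "cesaro_measure T \<nu> N = measure_pmf (pmf_of_set {..<N}) \<bind> (\<lambda>n. distr \<nu> borel (T ^^ n))"
    and "(\<lambda>n. distr \<nu> borel (T ^^ n)) \<in> measure_pmf (pmf_of_set {..<N}) \<rightarrow>\<^sub>M prob_algebra borel"
    and "prob_space (cesaro_measure T \<nu> N)"
proof -
  interpret \<nu>: prob_space \<nu> by fact
  note [measurable_cong] = \<nu>
  let ?P = "measure_pmf (pmf_of_set {..<N})" and ?D = "\<lambda>n. distr \<nu> borel (T ^^ n)"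
  have [measurable]: "(T ^^ n) \<in> borel_measurable borel" for n
    by (rule measurable_compose_n) simp
  have "prob_space (?D n)" for n by (intro \<nu>.prob_space_distr) measurable
  then show D: "?D \<in> ?P \<rightarrow>\<^sub>M prob_algebra borel"
    by (simp add: space_prob_algebra space_subprob_algebra prob_space_imp_subprob_space)
  then have D': "?D \<in> ?P \<rightarrow>\<^sub>M subprob_algebra borel" by (rule measurable_prob_algebraD)
  have ne: "{..<N} \<noteq> {}" using assms(4) by auto
  show eq: "cesaro_measure T \<nu> N = ?P \<bind> ?D"
  proof (rule measure_eqI)
    show "sets (cesaro_measure T \<nu> N) = sets (?P \<bind> ?D)" using D' by (simp add: sets_bind)
    fix A :: "'a set" assume "A \<in> sets (cesaro_measure T \<nu> N)"
    then have A: "A \<in> sets borel" by simp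
    show "emeasure (cesaro_measure T \<nu> N) A = emeasure (?P \<bind> ?D) A"
      using ne by (simp add: emeasure_cesaro_measure[OF A] emeasure_bind[OF _ D' A] nn_integral_pmf_of_set)
  qed
  show "prob_space (cesaro_measure T \<nu> N)"
    unfolding eq by (rule prob_space_bind'[OF _ D]) (simp add: space_prob_algebra measure_pmf.prob_space_axioms)
qed

lemma integral_cesaro_measure:
  fixes f :: "'a::topological_space \<Rightarrow> real"
  assumes [measurable]: "T \<in> borel_measurable borel" and "prob_space \<nu>" and \<nu>: "sets \<nu> = sets borel" and N: "0 < N"
    and [measurable]: "f \<in> borel_measurable borel" and C: "\<And>x. \<bar>f x\<bar> \<le> C"
  shows "(\<integral>x. f x \<partial>cesaro_measure T \<nu> N) = (\<Sum>n<N. \<integral>x. f ((T ^^ n) x) \<partial>\<nu>) / real N"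
proof -
  interpret \<nu>: prob_space \<nu> by fact
  interpret c: prob_space "cesaro_measure T \<nu> N" by (rule cesaro_measure_eq_bind) fact+
  note [measurable_cong] = \<nu>
  have [measurable]: "(T ^^ n) \<in> borel_measurable borel" for n
    by (rule measurable_compose_n) simp
  have nonneg: "(\<integral>x. g x \<partial>cesaro_measure T \<nu> N) = (\<Sum>n<N. \<integral>x. g ((T ^^ n) x) \<partial>\<nu>) / real N"
    if [measurable]: "g \<in> borel_measurable borel" and g: "\<And>x. 0 \<le> g x" "\<And>x. g x \<le> B" for g :: "'a \<Rightarrow> real" and B
  proof -
    let ?D = "\<lambda>n. distr \<nu> borel (T ^^ n)"
    have int: "integrable \<nu> (\<lambda>x. g ((T ^^ n) x))" for n
      by (rule \<nu>.integrable_const_bound[where B = B]) (use g in auto)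
    have ne: "{..<N} \<noteq> {}" using N by auto
    have "(\<integral>\<^sup>+x. g x \<partial>cesaro_measure T \<nu> N) = (\<integral>\<^sup>+n. \<integral>\<^sup>+x. g x \<partial>?D n \<partial>measure_pmf (pmf_of_set {..<N}))"
      unfolding cesaro_measure_eq_bind(1)[OF assms(1-4)]
      by (rule nn_integral_bind[OF _ measurable_prob_algebraD[OF cesaro_measure_eq_bind(2)[OF assms(1-4)]]]) simp
    also have "\<dots> = (\<Sum>n<N. \<integral>\<^sup>+x. g ((T ^^ n) x) \<partial>\<nu>) / N"
      using ne by (simp add: nn_integral_pmf_of_set nn_integral_distr)
    also have "\<dots> = (\<Sum>n<N. ennreal (\<integral>x. g ((T ^^ n) x) \<partial>\<nu>)) / N"
      using g by (simp add: nn_integral_eq_integral[OF int])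
    also have "\<dots> = ennreal ((\<Sum>n<N. \<integral>x. g ((T ^^ n) x) \<partial>\<nu>) / real N)"
      using g N by (simp add: sum_ennreal integral_nonneg_AE ennreal_of_nat_eq_real_of_nat divide_ennreal sum_nonneg)
    moreover have "0 \<le> (\<Sum>n<N. \<integral>x. g ((T ^^ n) x) \<partial>\<nu>) / real N"
      by (intro divide_nonneg_nonneg sum_nonneg Bochner_Integration.integral_nonneg) (use g in auto)
    ultimately show ?thesis
      using g by (subst integral_eq_nn_integral) auto
  qed
  \<comment> \<open>The formula was obtained through nonnegative integrals, hence it is applied to
    \<open>C + f\<close>; the constant cancels because both measures have mass 1.\<close>
  have "0 \<le> C + f x" "C + f x \<le> 2 * C" for x using C[of x] by auto
  then have "(\<integral>x. C + f x \<partial>cesaro_measure T \<nu> N) = (\<Sum>n<N. \<integral>x. C + f ((T ^^ n) x) \<partial>\<nu>) / real N"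
    by (intro nonneg[of "\<lambda>x. C + f x" "2 * C"]) auto
  moreover have "integrable (cesaro_measure T \<nu> N) f"
    by (rule c.integrable_const_bound[where B = C]) (use C in auto)
  moreover have "integrable \<nu> (\<lambda>x. f ((T ^^ n) x))" for n
    by (rule \<nu>.integrable_const_bound[where B = C]) (use C in auto)
  ultimately show ?thesis
    using N by (simp add: c.prob_space \<nu>.prob_space sum.distrib add_divide_distrib del: space_cesaro_measure)
qed

section \<open>Transfer of mean convergence from \<mu> to \<nu>\<close>

text \<open>\<open>\<nu>\<close> may be singular to \<open>\<mu>\<close>, so only integrals of fixed
  continuous functions carry over. The block average of fixed length \<open>K\<close> is such a
  function, and its averages along the orbit control the long Birkhoff averages.\<close>

lemma birkhoff_average_tendsto_0_L1_of_cesaro: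
  fixes \<mu> \<nu> :: "'a :: {t2_space, second_countable_topology} measure"
  assumes lc: "locally_compact_space (euclidean :: 'a topology)"
    and \<mu>: "prob_space \<mu>" "sets \<mu> = sets borel"
    and T: "continuous_on UNIV T" and erg: "ergodic_map \<mu> T"
    and \<nu>: "prob_space \<nu>" "sets \<nu> = sets borel"
    and conv: "weak_star_conv (cesaro_measure T \<nu>) \<mu>"
    and f: "continuous_on UNIV f" "\<And>x. \<bar>f x\<bar> \<le> C" and zero: "(\<integral>x. f x \<partial>\<mu>) = 0"
  shows "(\<lambda>N. \<integral>x. \<bar>birkhoff_sum T f N x / real N\<bar> \<partial>\<nu>) \<longlonglongrightarrow> 0"
proof -
  interpret \<nu>: prob_space \<nu> by fact
  have "0 \<le> C" using f(2)[of undefined] by linarith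
  note [measurable] = borel_measurable_continuous_onI[OF T] borel_measurable_continuous_onI[OF f(1)]
  note [measurable_cong] = \<nu>(2) \<mu>(2)
  have [measurable]: "(T ^^ n) \<in> borel_measurable borel" for n
    by (rule measurable_compose_n) simp
  obtain \<Phi> :: "nat \<Rightarrow> 'a \<Rightarrow> real"
    where \<Phi>: "\<And>i. \<Phi> i \<in> C_c" "\<And>i x. 0 \<le> \<Phi> i x"
    "\<And>\<psi>. continuous_on UNIV \<psi> \<Longrightarrow> (\<And>x. 0 \<le> \<psi> x) \<Longrightarrow>
       \<exists>s. (\<forall>j x. \<Phi> (s j) x \<le> \<psi> x) \<and> (\<forall>x. (\<lambda>j. \<Phi> (s j) x) \<longlonglongrightarrow> \<psi> x)"
    using countable_C_c_approx_from_below[OF lc] by blast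
  define F where "F = (\<lambda>K x. \<bar>birkhoff_sum T f K x / real K\<bar>)"
  have F_bd: "\<bar>F K x\<bar> \<le> C" for K x
    using birkhoff_sum_bound[of f C T K x, OF f(2)] \<open>0 \<le> C\<close>
    by (cases "K = 0") (auto simp: F_def field_simps)
  have F_cont: "continuous_on UNIV (F K)" for K
    unfolding F_def divide_inverse
    by (intro continuous_on_rabs continuous_on_mult_right continuous_on_birkhoff_sum T f)
  note [measurable] = borel_measurable_continuous_onI[OF F_cont]
  have F_int: "integrable \<nu> (F K)" for K
    by (rule \<nu>.integrable_const_bound[where B = C]) (use F_bd in auto)
  \<comment> \<open>\<open>F K\<close> need not have compact support, so the weak convergence is
    used on the \<open>\<Phi> k\<close> and extended by approximation from below.\<close>
  have F_lim: "(\<lambda>N. \<integral>x. F K x \<partial>cesaro_measure T \<nu> N) \<longlonglongrightarrow> (\<integral>x. F K x \<partial>\<mu>)" for K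
  proof (rule tendsto_integral_of_approx_from_below[OF \<Phi> \<mu> _ _ F_cont F_bd])
    show "eventually (\<lambda>N. prob_space (cesaro_measure T \<nu> N) \<and> sets (cesaro_measure T \<nu> N) = sets borel) sequentially"
      using eventually_gt_at_top[of 0]
      by eventually_elim (use \<nu> in \<open>auto intro: cesaro_measure_eq_bind\<close>)
    show "(\<lambda>N. \<integral>x. \<Phi> k x \<partial>cesaro_measure T \<nu> N) \<longlonglongrightarrow> (\<integral>x. \<Phi> k x \<partial>\<mu>)" for k
      using conv \<Phi>(1) unfolding weak_star_conv_def by blast
  qed auto
  have F_le: "(\<integral>x. F N x \<partial>\<nu>) \<le> (\<integral>x. F K x \<partial>cesaro_measure T \<nu> N) + 2 * real K * C / real N"
    if "0 < K" "0 < N" for K N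
  proof -
    have int: "integrable \<nu> (\<lambda>x. F K ((T ^^ n) x))" for n
      by (rule \<nu>.integrable_const_bound[where B = C]) (use F_bd in auto)
    have "(\<integral>x. F N x \<partial>\<nu>) \<le> (\<integral>x. (\<Sum>n<N. F K ((T ^^ n) x)) / real N + 2 * real K * C / real N \<partial>\<nu>)"
    proof (rule integral_mono[OF F_int])
      show "integrable \<nu> (\<lambda>x. (\<Sum>n<N. F K ((T ^^ n) x)) / real N + 2 * real K * C / real N)"
        using int by simp
      fix x
      have "\<bar>birkhoff_sum T f N x\<bar> \<le> (\<Sum>n<N. F K ((T ^^ n) x)) + 2 * real K * C"
        using birkhoff_sum_le_averaged[of f C K T N x, OF f(2) that(1)]
        unfolding F_def birkhoff_sum_def[of T "\<lambda>y. \<bar>birkhoff_sum T f K y / real K\<bar>"] .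
      moreover have "F N x = \<bar>birkhoff_sum T f N x\<bar> / real N" by (simp add: F_def)
      ultimately show "F N x \<le> (\<Sum>n<N. F K ((T ^^ n) x)) / real N + 2 * real K * C / real N"
        by (simp add: divide_right_mono flip: add_divide_distrib)
    qed
    also have "\<dots> = (\<integral>x. F K x \<partial>cesaro_measure T \<nu> N) + 2 * real K * C / real N"
      using int by (subst integral_cesaro_measure[where C = C]) (auto simp: F_bd \<nu> that \<nu>.prob_space)
    finally show ?thesis .
  qed
  have "(\<lambda>N. \<integral>x. F N x \<partial>\<nu>) \<longlonglongrightarrow> 0"
  proof (rule order_tendstoI)
    fix a :: real assume "a < 0"
    then show "eventually (\<lambda>N. a < (\<integral>x. F N x \<partial>\<nu>)) sequentially"
      by (intro always_eventually allI less_le_trans[OF _ integral_nonneg_AE]) (auto simp: F_def)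
  next
    fix a :: real assume "0 < a"
    have "(\<lambda>K. \<integral>x. F K x \<partial>\<mu>) \<longlonglongrightarrow> 0"
      unfolding F_def using birkhoff_average_tendsto_0_L1[OF \<mu>(1) erg _ f(2) zero] by simp
    then have "eventually (\<lambda>K. (\<integral>x. F K x \<partial>\<mu>) < a) sequentially"
      using \<open>0 < a\<close> by (rule order_tendstoD(2))
    \<comment> \<open>\<open>K\<close> is fixed before \<open>N\<close> grows, so that the error
      \<open>2 * K * C / N\<close> tends to 0.\<close>
    then obtain K where K: "(\<integral>x. F K x \<partial>\<mu>) < a" "0 < K"
      using eventually_gt_at_top[of "0::nat"]
      by (metis (mono_tags, lifting) eventually_conj eventually_happens' sequentially_bot)
    have "(\<lambda>N. (\<integral>x. F K x \<partial>cesaro_measure T \<nu> N) + 2 * real K * C / real N) \<longlonglongrightarrow> (\<integral>x. F K x \<partial>\<mu>) + 0"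
      by (intro tendsto_add F_lim lim_const_over_n)
    then have "eventually (\<lambda>N. (\<integral>x. F K x \<partial>cesaro_measure T \<nu> N) + 2 * real K * C / real N < a) sequentially"
      using K(1) by (intro order_tendstoD(2)) auto
    then show "eventually (\<lambda>N. (\<integral>x. F N x \<partial>\<nu>) < a) sequentially"
      using eventually_gt_at_top[of 0]
      by eventually_elim (use F_le[OF K(2)] in \<open>auto intro: le_less_trans\<close>)
  qed
  then show ?thesis by (simp add: F_def)
qed

section \<open>Sets of upper density one\<close>

lemma cesaro_mean_tendsto_0:
  fixes c :: "nat \<Rightarrow> real"
  assumes c: "c \<longlonglongrightarrow> 0" and nonneg: "\<And>n. 0 \<le> c n"
  shows "(\<lambda>M. (\<Sum>N=1..M. c N) / real M) \<longlonglongrightarrow> 0"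
proof (rule LIMSEQ_I)
  fix e :: real assume "0 < e"
  then obtain n0 where n0: "\<And>n. n0 \<le> n \<Longrightarrow> c n < e / 2"
    using order_tendstoD(2)[OF c, of "e / 2"] by (auto simp: eventually_sequentially)
  define S where "S = (\<Sum>N=1..n0. c N)"
  have "0 \<le> S" unfolding S_def by (intro sum_nonneg nonneg)
  obtain n1 :: nat where n1: "2 * S / e < real n1" using reals_Archimedean2 by blast
  show "\<exists>no. \<forall>M\<ge>no. norm ((\<Sum>N=1..M. c N) / real M - 0) < e"
  proof (intro exI allI impI)
    fix M assume M: "Suc (max n0 n1) \<le> M"
    have "(\<Sum>N=1..M. c N) = S + (\<Sum>N=Suc n0..M. c N)"
      using sum.ub_add_nat[of 1 n0 c "M - n0"] M by (simp add: S_def)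
    also have "(\<Sum>N=Suc n0..M. c N) \<le> (\<Sum>N=Suc n0..M. e / 2)"
      by (intro sum_mono) (use n0 in \<open>auto intro: less_imp_le\<close>)
    also have "\<dots> \<le> real M * (e / 2)" using \<open>0 < e\<close> by simp
    finally have "(\<Sum>N=1..M. c N) \<le> S + real M * (e / 2)" by simp
    moreover have "S < real M * (e / 2)"
    proof -
      have "2 * S / e < real M" using n1 M by linarith
      then show ?thesis using \<open>0 < e\<close> by (simp add: field_simps)
    qed
    ultimately have "(\<Sum>N=1..M. c N) < real M * e" by linarith
    then show "norm ((\<Sum>N=1..M. c N) / real M - 0) < e"
      using M by (simp add: abs_of_nonneg sum_nonneg nonneg field_simps)
  qed
qed

text \<open>A one-sided form of the Koopman--von Neumann lemma: Markov's inequality at the threshold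
  \<open>sqrt a\<close> leaves out at most a proportion \<open>sqrt a\<close> of \<open>{1..M}\<close> when the mean over \<open>{1..M}\<close> is \<open>a\<close>.
  Since the thresholds must not depend on \<open>M\<close>, the supremum over all later means is used.\<close>

lemma exists_upper_density_1_tendsto_0:
  fixes h :: "nat \<Rightarrow> real"
  assumes nonneg: "\<And>N. 0 \<le> h N" and r: "strict_mono r"
    and lim: "(\<lambda>j. (\<Sum>N=1..r j. h N) / real (r j)) \<longlonglongrightarrow> 0"
  shows "\<exists>A. upper_density A = 1 \<and> (h \<longlongrightarrow> 0) (inf sequentially (principal A))"
proof -
  define a where "a = (\<lambda>j. (\<Sum>N=1..r j. h N) / real (r j))"
  have a_nonneg: "0 \<le> a j" for j unfolding a_def by (intro divide_nonneg_nonneg sum_nonneg nonneg) auto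
  have a_lim: "a \<longlonglongrightarrow> 0" using lim by (simp add: a_def)
  have r_ge: "j \<le> r j" for j using r by (rule seq_suble)
  define s where "s = (\<lambda>N. SUP j\<in>{j. N \<le> r j}. a j)"
  \<comment> \<open>The real supremum in \<open>s N\<close> is meaningful because \<open>a\<close>,
    being convergent, is bounded, and because \<open>j \<le> r j\<close> makes the index set
    nonempty.\<close>
  obtain B where B: "\<And>j. a j \<le> B"
    using Bseq_eq_bounded[of a] convergent_imp_Bseq[OF convergentI[OF a_lim]]
    by (metis BseqE abs_le_D1 real_norm_def)
  have bdd: "bdd_above (a ` {j. N \<le> r j})" for N by (rule bdd_aboveI2) (rule B)
  have s_ge: "a j \<le> s N" if "N \<le> r j" for j N
    unfolding s_def by (rule cSUP_upper[OF _ bdd]) (use that in auto)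
  have s_nonneg: "0 \<le> s N" for N using s_ge[OF r_ge[of N]] a_nonneg[of N] by linarith
  have s_lim: "s \<longlonglongrightarrow> 0"
  proof (rule LIMSEQ_I)
    fix e :: real assume "0 < e"
    then obtain J where J: "\<And>j. J \<le> j \<Longrightarrow> a j < e / 2"
      using order_tendstoD(2)[OF a_lim, of "e / 2"] by (auto simp: eventually_sequentially)
    show "\<exists>no. \<forall>N\<ge>no. norm (s N - 0) < e"
    proof (intro exI allI impI)
      \<comment> \<open>From \<open>r J \<le> N\<close> and \<open>N \<le> r j\<close> follows
        \<open>J \<le> j\<close>, so every mean entering \<open>s N\<close> is small. The supremum
        keeps only a weak inequality, hence \<open>e / 2\<close>.\<close>
      fix N assume N: "r J \<le> N"
      have "s N \<le> e / 2"
        unfolding s_def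
      proof (rule cSUP_least)
        show "{j. N \<le> r j} \<noteq> {}" using r_ge by blast
        fix j assume "j \<in> {j. N \<le> r j}"
        then have "r J \<le> r j" using N by simp
        then have "J \<le> j" using r by (simp add: strict_mono_less_eq)
        then show "a j \<le> e / 2" using J by (simp add: less_imp_le)
      qed
      then show "norm (s N - 0) < e" using s_nonneg[of N] \<open>0 < e\<close> by simp
    qed
  qed
  define A where "A = {N. h N \<le> sqrt (s N)}"
  have "(h \<longlongrightarrow> 0) (inf sequentially (principal A))"
  proof (rule tendsto_sandwich)
    show "eventually (\<lambda>N. 0 \<le> h N) (inf sequentially (principal A))" using nonneg by simp
    show "eventually (\<lambda>N. h N \<le> sqrt (s N)) (inf sequentially (principal A))"
      by (simp add: eventually_inf_principal A_def)
    have "(\<lambda>N. sqrt (s N)) \<longlonglongrightarrow> 0" using tendsto_real_sqrt[OF s_lim] by simp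
    then show "((\<lambda>N. sqrt (s N)) \<longlongrightarrow> 0) (inf sequentially (principal A))"
      by (rule tendsto_mono[rotated]) simp
  qed simp
  moreover have "upper_density A = 1"
  proof (rule antisym)
    have "real (card (A \<inter> {1..N})) / real N \<le> 1" for N
      using card_mono[of "{1..N}" "A \<inter> {1..N}"] by (simp add: divide_le_eq)
    then show "upper_density A \<le> 1"
      unfolding upper_density_def by (intro Limsup_bounded always_eventually) (auto simp: one_ereal_def)
    define d where "d = (\<lambda>N. real (card (A \<inter> {1..N})) / real N)"
    \<comment> \<open>For \<open>N\<close> up to \<open>r j\<close>, \<open>a j\<close> is one of
      the means in \<open>s N\<close>. Outside \<open>A\<close>, \<open>h N\<close> therefore
      exceeds \<open>sqrt (a j)\<close>, and Markov's inequality bounds the number of such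
      \<open>N\<close>. The condition \<open>0 < j\<close> keeps \<open>r j\<close>
      positive.\<close>
    have d_ge: "1 - sqrt (a j) \<le> d (r j)" if "0 < j" for j
    proof -
      have rj: "0 < r j" using r_ge[of j] that by simp
      let ?bad = "{1..r j} - A"
      have bad: "sqrt (a j) < h N" if "N \<in> ?bad" for N
      proof -
        have "a j \<le> s N" using that by (intro s_ge) auto
        then have "sqrt (a j) \<le> sqrt (s N)" by simp
        moreover have "sqrt (s N) < h N" using that by (simp add: A_def)
        ultimately show ?thesis by (rule le_less_trans)
      qed
      have sum_bad: "(\<Sum>N\<in>?bad. h N) \<le> real (r j) * a j"
        using sum_mono2[of "{1..r j}" ?bad h] nonneg rj by (auto simp: a_def)
      have "real (card ?bad) \<le> real (r j) * sqrt (a j)"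
      \<comment> \<open>Markov's inequality divides by \<open>sqrt (a j)\<close>. If this is 0, the
        exceptional terms would be strictly positive with sum at most 0, so there are none.\<close>
      proof (cases "a j = 0")
        case True
        have "?bad = {}"
        proof (rule ccontr)
          assume "?bad \<noteq> {}"
          then have "0 < (\<Sum>N\<in>?bad. h N)" using bad True by (intro sum_pos) auto
          then show False using sum_bad True by simp
        qed
        then show ?thesis using True by (simp only: card.empty) simp
      next
        case False
        then have pos: "0 < sqrt (a j)" using a_nonneg[of j] by simp
        have "real (card ?bad) * sqrt (a j) \<le> (\<Sum>N\<in>?bad. h N)"
          by (rule sum_bounded_below) (use bad in \<open>auto intro: less_imp_le\<close>)
        also have "\<dots> \<le> real (r j) * (sqrt (a j) * sqrt (a j))" using sum_bad a_nonneg[of j] by simp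
        finally have "real (card ?bad) * sqrt (a j) \<le> (real (r j) * sqrt (a j)) * sqrt (a j)"
          by (simp only: mult.assoc)
        then show ?thesis using pos by (rule mult_right_le_imp_le)
      qed
      moreover have "r j = card ?bad + card (A \<inter> {1..r j})"
      proof -
        have "card (?bad \<union> (A \<inter> {1..r j})) = card ?bad + card (A \<inter> {1..r j})"
          by (rule card_Un_disjoint) auto
        moreover have "?bad \<union> (A \<inter> {1..r j}) = {1..r j}" by auto
        ultimately show ?thesis by simp
      qed
      ultimately have "real (r j) * (1 - sqrt (a j)) \<le> real (card (A \<inter> {1..r j}))"
        by (simp add: algebra_simps flip: of_nat_add)
      then show ?thesis using rj by (simp add: d_def le_divide_eq mult.commute)
    qed
    have "(\<lambda>j. 1 - sqrt (a j)) \<longlonglongrightarrow> 1 - sqrt 0"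
      by (intro tendsto_diff tendsto_const tendsto_real_sqrt a_lim)
    then have "limsup (\<lambda>j. ereal (1 - sqrt (a j))) = 1"
      by (intro lim_imp_Limsup) (simp_all add: one_ereal_def)
    then have "1 = limsup (\<lambda>j. ereal (1 - sqrt (a j)))" by simp
    also have "\<dots> \<le> limsup (\<lambda>j. ereal (d (r j)))"
      by (intro Limsup_mono eventually_mono[OF eventually_gt_at_top[of 0]]) (simp add: d_ge)
    also have "\<dots> \<le> limsup (\<lambda>N. ereal (d N))"
      using limsup_subseq_mono[OF r, of "\<lambda>N. ereal (d N)"] by (simp add: o_def)
    finally show "1 \<le> upper_density A" by (simp add: upper_density_def d_def)
  qed
  ultimately show ?thesis by blast
qed

section \<open>Almost everywhere convergence along a set of upper density one\<close>

theorem theorem1p1: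
  fixes \<mu> \<nu> :: "'a :: {t2_space, second_countable_topology} measure"
    and T :: "'a \<Rightarrow> 'a"
  assumes "locally_compact_space (euclidean :: 'a topology)"
    and "prob_space \<mu>" and "sets \<mu> = sets borel"
    and "continuous_on UNIV T"
    and "measure_preserving_map \<mu> T"
    and "ergodic_map \<mu> T"
    and "prob_space \<nu>" and "sets \<nu> = sets borel"
    and "weak_star_conv (cesaro_measure T \<nu>) \<mu>"
  shows "AE x in \<nu>. \<exists>A :: nat set. upper_density A = 1 \<and>
           (\<forall>\<psi>\<in>C_c. ((\<lambda>N. (\<Sum>n<N. \<psi> ((T ^^ n) x)) / real N)
              \<longlongrightarrow> (\<integral>y. \<psi> y \<partial>\<mu>)) (inf sequentially (principal A)))"
proof -
  interpret \<mu>: prob_space \<mu> by fact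
  interpret \<nu>: prob_space \<nu> by fact
  note \<mu> = assms(2,3) and T = assms(4) and \<nu> = assms(7,8)
  note [measurable_cong] = \<nu>(2) \<mu>(2)
  note [measurable] = borel_measurable_continuous_onI[OF T]
  obtain \<Phi> :: "nat \<Rightarrow> 'a \<Rightarrow> real"
    where \<Phi>: "\<And>i. \<Phi> i \<in> C_c" "\<And>i x. 0 \<le> \<Phi> i x"
    "\<And>\<psi>. continuous_on UNIV \<psi> \<Longrightarrow> (\<And>x. 0 \<le> \<psi> x) \<Longrightarrow>
       \<exists>s. (\<forall>j x. \<Phi> (s j) x \<le> \<psi> x) \<and> (\<forall>x. (\<lambda>j. \<Phi> (s j) x) \<longlonglongrightarrow> \<psi> x)"
    using countable_C_c_approx_from_below[OF assms(1)] by blast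
  have \<Phi>_cont: "continuous_on UNIV (\<Phi> i)" for i using \<Phi>(1)[of i] by (simp add: C_c_def)
  note [measurable] = borel_measurable_continuous_onI[OF \<Phi>_cont]
  \<comment> \<open>Centring by the means gives the zero integral required for the mean convergence;
    compact support is in general lost.\<close>
  define c where "c = (\<lambda>i. \<integral>x. \<Phi> i x \<partial>\<mu>)"
  define d where "d = (\<lambda>i N x. \<bar>birkhoff_sum T (\<lambda>x. \<Phi> i x - c i) N x / real N\<bar>)"
  have [measurable]: "d i N \<in> borel_measurable borel" for i N
    unfolding d_def[abs_def] by measurable
  have d_lim: "(\<lambda>N. \<integral>x. d i N x \<partial>\<nu>) \<longlonglongrightarrow> 0" and d_int: "integrable \<nu> (d i N)" for i N
  proof -
    obtain C where C: "\<And>x. \<bar>\<Phi> i x\<bar> \<le> C" using C_c_bounded[OF \<Phi>(1)] by blast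
    have bd: "\<bar>\<Phi> i x - c i\<bar> \<le> C + \<bar>c i\<bar>" for x using C[of x] by linarith
    have "integrable \<mu> (\<Phi> i)" by (rule \<mu>.integrable_const_bound[where B = C]) (use C in auto)
    then have "(\<integral>x. \<Phi> i x - c i \<partial>\<mu>) = 0" by (simp add: c_def \<mu>.prob_space)
    then show "(\<lambda>N. \<integral>x. d i N x \<partial>\<nu>) \<longlonglongrightarrow> 0"
      unfolding d_def
      by (intro birkhoff_average_tendsto_0_L1_of_cesaro[OF assms(1-4,6-9) _ bd]
            continuous_on_diff continuous_on_const \<Phi>_cont)
    have "\<bar>d i N x\<bar> \<le> C + \<bar>c i\<bar>" for x
      using birkhoff_sum_bound[of "\<lambda>x. \<Phi> i x - c i" "C + \<bar>c i\<bar>" T N x, OF bd] C[of x]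
      by (cases "N = 0") (auto simp: d_def field_simps)
    then show "integrable \<nu> (d i N)"
      by (intro \<nu>.integrable_const_bound[where B = "C + \<bar>c i\<bar>"]) auto
  qed
  \<comment> \<open>The bounds of the \<open>\<Phi> i\<close> need not be uniform in
    \<open>i\<close>. Truncation at 1 gives the weighted terms the summable bound
    \<open>(1 / 2) ^ i\<close>, independent of \<open>N\<close> and \<open>x\<close>, so limit and
    series can be exchanged.\<close>
  define t where "t = (\<lambda>i N x. (1 / 2) ^ i * min 1 (d i N x))"
  have t0: "0 \<le> t i N x" and t1: "t i N x \<le> (1 / 2) ^ i" and td: "t i N x \<le> d i N x" for i N x
  proof -
    have "0 \<le> min 1 (d i N x)" by (simp add: d_def)
    then show "0 \<le> t i N x" "t i N x \<le> (1 / 2) ^ i" "t i N x \<le> d i N x"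
      unfolding t_def
      by (auto intro: mult_left_le mult_left_le_one_le[THEN order_trans] simp: power_le_one)
  qed
  have [measurable]: "t i N \<in> borel_measurable borel" for i N
    unfolding t_def[abs_def] by measurable
  have t_int: "integrable \<nu> (t i N)" for i N
    by (rule \<nu>.integrable_const_bound[where B = "(1 / 2) ^ i"]) (use t0 t1 in auto)
  have t_int_le: "(\<integral>x. t i N x \<partial>\<nu>) \<le> (1 / 2) ^ i" for i N
    using integral_mono[OF t_int[of i N], of "\<lambda>_. (1 / 2) ^ i"] t1 by (simp add: \<nu>.prob_space)
  have t_int_ge: "0 \<le> (\<integral>x. t i N x \<partial>\<nu>)" for i N
    using t0 by simp
  have t_lim: "(\<lambda>N. \<integral>x. t i N x \<partial>\<nu>) \<longlonglongrightarrow> 0" for i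
    by (rule tendsto_sandwich[OF _ _ tendsto_const d_lim[of i]])
       (auto intro!: always_eventually t_int_ge integral_mono t_int d_int td)
  have geom: "summable (\<lambda>i. (1 / 2 :: real) ^ i)" by (rule summable_geometric) simp
  have t_summable: "summable (\<lambda>i. t i N x)" for N x
    by (rule summable_comparison_test'[OF geom]) (use t0 t1 in auto)
  have t_int_summable: "summable (\<lambda>i. \<integral>x. t i N x \<partial>\<nu>)" for N
    by (rule summable_comparison_test'[OF geom]) (use t_int_ge t_int_le in auto)
  define h where "h = (\<lambda>N x. \<Sum>i. t i N x)"
  have h0: "0 \<le> h N x" for N x unfolding h_def by (intro suminf_nonneg t_summable t0)
  have h_ge: "t i N x \<le> h N x" for i N x
    unfolding h_def using sum_le_suminf[OF t_summable, of "{i}" N x] t0 by simp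
  have h_int: "integrable \<nu> (h N)" and h_integral: "(\<integral>x. h N x \<partial>\<nu>) = (\<Sum>i. \<integral>x. t i N x \<partial>\<nu>)" for N
    unfolding h_def using integrable_suminf[of \<nu> "\<lambda>i. t i N"] integral_suminf[of \<nu> "\<lambda>i. t i N"]
    by (simp_all add: t_int t_summable t_int_summable t0 abs_of_nonneg)
  have "(\<lambda>N. \<Sum>i. \<integral>x. t i N x \<partial>\<nu>) \<longlonglongrightarrow> (\<Sum>i::nat. 0)"
    using t_lim
  proof (rule tannerys_theorem[THEN conjunct2, THEN conjunct2])
    show "eventually (\<lambda>(i, N). norm (\<integral>x. t i N x \<partial>\<nu>) \<le> (1 / 2) ^ i) (at_top \<times>\<^sub>F sequentially)"
      using t_int_ge t_int_le by (intro always_eventually) auto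
  qed (use geom in auto)
  then have h_lim: "(\<lambda>N. \<integral>x. h N x \<partial>\<nu>) \<longlonglongrightarrow> 0" by (simp add: h_integral)
  \<comment> \<open>The means run over \<open>1..M\<close>, matching the count in
    \<open>upper_density\<close>. Convergence of their integrals to 0 yields almost everywhere
    convergence only along a subsequence \<open>r\<close>, which is why the density obtained is an
    upper one.\<close>
  define u where "u = (\<lambda>M x. (\<Sum>N=1..M. h N x) / real M)"
  have u0: "0 \<le> u M x" for M x unfolding u_def by (intro divide_nonneg_nonneg sum_nonneg h0) auto
  have u_int: "integrable \<nu> (u M)" for M unfolding u_def by (intro integrable_divide Bochner_Integration.integrable_sum h_int)
  have "(\<lambda>M. \<integral>x. norm (u M x) \<partial>\<nu>) = (\<lambda>M. (\<Sum>N=1..M. \<integral>x. h N x \<partial>\<nu>) / real M)"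
    using u0 h_int by (simp add: fun_eq_iff abs_of_nonneg) (simp add: u_def)
  also have "\<dots> \<longlonglongrightarrow> 0" by (intro cesaro_mean_tendsto_0 h_lim) (simp add: h0)
  finally obtain r where r: "strict_mono r" "AE x in \<nu>. (\<lambda>j. u (r j) x) \<longlonglongrightarrow> 0"
    using tendsto_L1_AE_subseq[of \<nu> u, OF u_int] by blast
  from r(2) show ?thesis
  proof eventually_elim
    case (elim x)
    \<comment> \<open>\<open>A\<close> is obtained from \<open>h\<close> before any test function is
      chosen; since \<open>h\<close> dominates every \<open>t i\<close>, one set serves all
      \<open>i\<close>.\<close>
    obtain A where A: "upper_density A = 1" and h_A: "((\<lambda>N. h N x) \<longlongrightarrow> 0) (inf sequentially (principal A))"
      using exists_upper_density_1_tendsto_0[of "\<lambda>N. h N x" r, OF h0 r(1)] elim unfolding u_def by blast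
    \<comment> \<open>Averages along the orbit of \<open>x\<close> are integrals against the Cesaro
      measures of the point mass at \<open>x\<close>, so the approximation from below applies to
      them along \<open>A\<close>.\<close>
    let ?F = "inf sequentially (principal A)" and ?\<delta> = "return borel x"
    have pos: "eventually (\<lambda>N. 0 < N) ?F"
      using eventually_gt_at_top[of 0] filter_leD[OF inf_le1] by blast
    have \<delta>: "prob_space ?\<delta>" "sets ?\<delta> = sets borel" by (auto intro: prob_space_return)
    have avg: "(\<integral>y. f y \<partial>cesaro_measure T ?\<delta> N) = birkhoff_sum T f N x / real N"
      if "0 < N" "continuous_on UNIV f" "\<And>y. \<bar>f y\<bar> \<le> C" for f :: "'a \<Rightarrow> real" and N C
    proof -
      note [measurable] = borel_measurable_continuous_onI[OF that(2)]
      have [measurable]: "(T ^^ n) \<in> borel_measurable borel" for n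
        by (rule measurable_compose_n) simp
      show ?thesis
        unfolding birkhoff_sum_def
        by (subst integral_cesaro_measure[OF _ \<delta> that(1) _ that(3)]) (auto simp: integral_return)
    qed
    have \<Phi>_lim: "((\<lambda>N. \<integral>y. \<Phi> i y \<partial>cesaro_measure T ?\<delta> N) \<longlongrightarrow> c i) ?F" for i
    proof -
      obtain C where C: "\<And>y. \<bar>\<Phi> i y\<bar> \<le> C" using C_c_bounded[OF \<Phi>(1)] by blast
      have "((\<lambda>N. t i N x) \<longlongrightarrow> 0) ?F"
        by (rule tendsto_sandwich[OF _ _ tendsto_const h_A]) (simp_all add: t0 h_ge)
      then have "((\<lambda>N. 2 ^ i * t i N x) \<longlongrightarrow> 2 ^ i * 0) ?F" by (intro tendsto_mult tendsto_const)
      then have min_lim: "((\<lambda>N. min 1 (d i N x)) \<longlongrightarrow> 0) ?F"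
        by (simp add: t_def mult.assoc[symmetric] power_mult_distrib[symmetric])
      \<comment> \<open>The truncation is harmless: once the minimum is below 1, it equals
        \<open>d i N x\<close>.\<close>
      then have "eventually (\<lambda>N. min 1 (d i N x) < 1) ?F" by (rule order_tendstoD(2)) simp
      then have "eventually (\<lambda>N. min 1 (d i N x) = d i N x) ?F" by eventually_elim simp
      with min_lim have "((\<lambda>N. d i N x) \<longlongrightarrow> 0) ?F" by (rule Lim_transform_eventually)
      then have "((\<lambda>N. birkhoff_sum T (\<lambda>x. \<Phi> i x - c i) N x / real N) \<longlongrightarrow> 0) ?F"
        unfolding d_def by (rule tendsto_rabs_zero_cancel)
      then have "((\<lambda>N. birkhoff_sum T (\<lambda>x. \<Phi> i x - c i) N x / real N + c i) \<longlongrightarrow> 0 + c i) ?F"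
        by (intro tendsto_add tendsto_const)
      moreover have "eventually (\<lambda>N. birkhoff_sum T (\<lambda>x. \<Phi> i x - c i) N x / real N + c i
          = (\<integral>y. \<Phi> i y \<partial>cesaro_measure T ?\<delta> N)) ?F"
        using pos by eventually_elim
          (simp add: avg[OF _ \<Phi>_cont C] birkhoff_sum_diff_const field_simps)
      ultimately show ?thesis using Lim_transform_eventually by fastforce
    qed
    have "((\<lambda>N. (\<Sum>n<N. \<psi> ((T ^^ n) x)) / real N) \<longlongrightarrow> (\<integral>y. \<psi> y \<partial>\<mu>)) ?F" if "\<psi> \<in> C_c" for \<psi>
    proof -
      obtain C where C: "\<And>y. \<bar>\<psi> y\<bar> \<le> C" using C_c_bounded[OF \<open>\<psi> \<in> C_c\<close>] by blast
      have cont: "continuous_on UNIV \<psi>" using that by (simp add: C_c_def)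
      have "((\<lambda>N. \<integral>y. \<psi> y \<partial>cesaro_measure T ?\<delta> N) \<longlongrightarrow> (\<integral>y. \<psi> y \<partial>\<mu>)) ?F"
      proof (rule tendsto_integral_of_approx_from_below[OF \<Phi> \<mu> _ _ cont C])
        show "eventually (\<lambda>N. prob_space (cesaro_measure T ?\<delta> N) \<and> sets (cesaro_measure T ?\<delta> N) = sets borel) ?F"
          using pos by eventually_elim (use \<delta> in \<open>auto intro: cesaro_measure_eq_bind\<close>)
      qed (use \<Phi>_lim in \<open>auto simp: c_def\<close>)
      moreover have "eventually (\<lambda>N. (\<integral>y. \<psi> y \<partial>cesaro_measure T ?\<delta> N)
          = (\<Sum>n<N. \<psi> ((T ^^ n) x)) / real N) ?F"
        using pos by eventually_elim (simp add: avg[OF _ cont C] birkhoff_sum_def)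
      ultimately show ?thesis by (rule Lim_transform_eventually)
    qed
    with A show ?case by blast
  qed
qed

end
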